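(* Let $d,M\in\mathbb{N}$ (positive integers), let $t_1,\dots,t_M\in[0,1)^d$ be pairwise distinct, let $\hat f_1,\dots,\hat f_M\in\mathbb{C}\setminus\{0\}$, put $x_j=(\mathrm{e}^{2\pi\mathrm{i}t_{j,1}},\dots,\mathrm{e}^{2\pi\mathrm{i}t_{j,d}})\in\mathbb{T}^d$, $\Omega=\{x_1,\dots,x_M\}$, and let $$f\colon\mathbb{Z}^d\to\mathbb{C},\quad f(k)=\sum_{j=1}^M\hat f_j\,x_j^k ,$$ be the corresponding $M$-sparse $d$-variate exponential sum. Let $q>0$ and suppose that the parameters are $q$-separated, i.e. $\operatorname{sep}(\Omega)>q$. If $n\in\mathbb{N}_0$ satisfies $n>d^{3/2}/q+d+1$, then $$\Omega=\mathcal{V}(\ker T_n),$$ where $T_n\in\mathbb{C}^{(n+1)^d\times(n+1)^d}$ is the matrix of trigonometric moments of order up to $n$ whose entry in row $\ell$ and column $k$ is $f(k-\ell)$, for $k,\ell\in\{0,\dots,n\}^d$.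
   Context: $\mathbb{T}^d=\{z\in\mathbb{C}:|z|=1\}^d$, and $x^k=x_1^{k_1}\cdots x_d^{k_d}$ for $k\in\mathbb{Z}^d$, $x\in\mathbb{T}^d$. The separation distance is $\operatorname{sep}(\Omega)=\min_{r\in\mathbb{Z}^d,\,j\ne\ell}\|t_j-t_\ell+r\|_\infty$ (for $M=1$ there is no pair $j\neq\ell$ and the separation condition is regarded as satisfied). A vector $(p_k)_{k\in\{0,\dots,n\}^d}\in\mathbb{C}^{(n+1)^d}$ is identified with the polynomial $p=\sum_{k}p_kX_1^{k_1}\cdots X_d^{k_d}\in\mathbb{C}[X_1,\dots,X_d]$; under this identification $\ker T_n$ (all vectors $p$ with $T_np=0$) is a set of polynomials. For a set $P$ of polynomials, $\mathcal{V}(P)=\{x\in\mathbb{C}^d:p(x)=0\text{ for all }p\in P\}$. *)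

theory Defs
  imports "HOL-Analysis.Analysis" "HOL-Library.Poly_Mapping"
begin

definition mono_int :: "complex ^ 'd \<Rightarrow> int ^ 'd \<Rightarrow> complex" where
  "mono_int x k = (\<Prod>i\<in>UNIV. (x $ i) powi (k $ i))"

definition expsum :: "nat \<Rightarrow> (nat \<Rightarrow> complex) \<Rightarrow> (nat \<Rightarrow> complex ^ 'd) \<Rightarrow> int ^ 'd \<Rightarrow> complex" where
  "expsum M fhat x k = (\<Sum>j = 1..M. fhat j * mono_int (x j) k)"

definition torus_point :: "real ^ 'd \<Rightarrow> complex ^ 'd" where
  "torus_point s = (\<chi> i. exp (2 * of_real pi * \<i> * of_real (s $ i)))"

text \<open>
  The infimum below is a minimum as soon as there is a pair of distinct indices. For \<open>M \<le> 1\<close> it is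
  taken over the empty set and has no meaning, so this case must be treated separately at each use.
\<close>

definition sep :: "nat \<Rightarrow> (nat \<Rightarrow> real ^ 'd) \<Rightarrow> real" where
  "sep M t = Inf {infnorm (t j - t l + (\<chi> i. of_int (r $ i))) | j l (r :: int ^ 'd).
     j \<in> {1..M} \<and> l \<in> {1..M} \<and> j \<noteq> l}"

definition index_cube :: "nat \<Rightarrow> (nat ^ 'd) set" where
  "index_cube n = {k. \<forall>i. k $ i \<le> n}"

text \<open>
  Matrices and vectors indexed by \<open>index_cube n\<close> are functions on \<open>nat ^ 'd\<close>, of which only the
  values on the cube matter; vectors are normalised to vanish outside the cube.
\<close>

definition moment_matrix :: "(int ^ 'd \<Rightarrow> complex) \<Rightarrow> nat ^ 'd \<Rightarrow> nat ^ 'd \<Rightarrow> complex" where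
  "moment_matrix f l k = f (\<chi> i. int (k $ i) - int (l $ i))"

definition cube_kernel :: "nat \<Rightarrow> (nat ^ 'd \<Rightarrow> nat ^ 'd \<Rightarrow> complex) \<Rightarrow> (nat ^ 'd \<Rightarrow> complex) set" where
  "cube_kernel n A = {p. (\<forall>k. k \<notin> index_cube n \<longrightarrow> p k = 0) \<and>
     (\<forall>l\<in>index_cube n. (\<Sum>k\<in>index_cube n. A l k * p k) = 0)}"

text \<open>
  The polynomial ring in indeterminates indexed by \<open>'d\<close>, as the monoid algebra of the exponent
  vectors: \<open>Poly_Mapping.single k c\<close> is the term with exponent \<open>k\<close> and coefficient \<open>c\<close>.
\<close>

type_synonym 'd cpoly = "(nat ^ 'd) \<Rightarrow>\<^sub>0 complex"

definition poly_of_vec :: "nat \<Rightarrow> (nat ^ 'd \<Rightarrow> complex) \<Rightarrow> 'd cpoly" where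
  "poly_of_vec n p = (\<Sum>k\<in>index_cube n. Poly_Mapping.single k (p k))"

definition eval_cpoly :: "'d cpoly \<Rightarrow> complex ^ 'd \<Rightarrow> complex" where
  "eval_cpoly p x =
     (\<Sum>k\<in>Poly_Mapping.keys p. Poly_Mapping.lookup p k * (\<Prod>i\<in>UNIV. (x $ i) ^ (k $ i)))"

definition zero_locus :: "'d cpoly set \<Rightarrow> (complex ^ 'd) set" where
  "zero_locus P = {x. \<forall>p\<in>P. eval_cpoly p x = 0}"

end

theory Submission
  imports Defs "HOL-Real_Asymp.Real_Asymp"
begin

text \<open>
  Everything rests on the linear independence of the exponentials \<open>k \<mapsto> x\<^sub>j\<^sup>k\<close> on the smaller cube
  \<open>{0..n-1}\<^sup>d\<close>. As the \<open>l\<close>-th entry of \<open>T\<^sub>n p\<close> is the sum of \<open>fhat\<^sub>j p(x\<^sub>j) cnj (x\<^sub>j\<^sup>l)\<close> over \<open>j\<close>, independence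
  shows that the kernel consists of the polynomials vanishing on \<open>\<Omega>\<close>. If all of these vanish at \<open>y\<close>,
  then by duality \<open>y\<^sup>k = \<Sum>\<^sub>j c\<^sub>j x\<^sub>j\<^sup>k\<close> on the cube for some \<open>c\<close>; comparing exponents that differ by one in
  the \<open>i\<close>-th coordinate and using independence again gives \<open>c\<^sub>j (x\<^sub>j\<^sub>,\<^sub>i - y\<^sub>i) = 0\<close>. Since the \<open>c\<^sub>j\<close> sum to 1,
  some \<open>x\<^sub>j\<close> equals \<open>y\<close>.

  For \<open>d = 1\<close> independence holds by a Vandermonde argument, because separation leaves room for at
  most \<open>n\<close> points. For \<open>d \<ge> 2\<close> we use an Ingham-type minorant \<open>W\<close>: it vanishes on all
  differences \<open>t\<^sub>j - t\<^sub>l\<close> of distinct nodes, is positive at 0, and has nonpositive Fourier coefficients outside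
  the centred cube. A linear relation between the exponentials on the cube then makes
  \<open>W(0) \<Sum>\<^sub>j \<bar>c\<^sub>j\<bar>\<^sup>2 = \<Sum>\<^sub>j\<^sub>,\<^sub>l c\<^sub>j cnj c\<^sub>l W(t\<^sub>j - t\<^sub>l)\<close> nonpositive. The function \<open>W\<close> is
  \<open>(1 + b/(4 pi\<^sup>2) \<Delta>)\<close> applied to a product of cubic B-splines.
\<close>

section \<open>Fourier series of piecewise polynomials\<close>

text \<open>The differentiated series is dominated by a constant multiple of the assumed one, so the
  Weierstrass M-test applies; convergence of the original series at a single base point completes
  the argument.\<close>

lemma DERIV_cos_series:
  fixes a :: "nat \<Rightarrow> real"
  assumes "summable (\<lambda>n. \<bar>a n\<bar> * real n)"
  shows "((\<lambda>x. suminf (\<lambda>n. a n * cos (2 * pi * real n * x))) has_field_derivative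
          suminf (\<lambda>n. - (2 * pi * (a n * real n) * sin (2 * pi * real n * x)))) (at x)"
proof (rule has_field_derivative_series'(2)[where S = UNIV and ?x0.0 = "1/4"])
  show "((\<lambda>x. a n * cos (2 * pi * real n * x)) has_field_derivative
          - (2 * pi * (a n * real n) * sin (2 * pi * real n * x))) (at x)" for n x
    by (auto intro!: derivative_eq_intros simp: algebra_simps)
  have "summable (\<lambda>n. 2 * pi * (\<bar>a n\<bar> * real n))"
    by (intro summable_mult assms)
  then show "uniformly_convergent_on UNIV
      (\<lambda>n x. \<Sum>i<n. - (2 * pi * (a i * real i) * sin (2 * pi * real i * x)))"
    by (rule Weierstrass_m_test'[rotated])
       (auto simp: abs_mult intro!: mult_left_mono mult_left_le)
  \<comment> \<open>The comparison starts at index 1, because the factor \<open>real n\<close> hides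
    the constant term \<open>a 0\<close>.\<close>
  show "summable (\<lambda>n. a n * cos (2 * pi * real n * (1/4)))"
  proof (rule summable_comparison_test'[OF assms, of 1])
    fix n :: nat assume "n \<ge> 1"
    have "\<bar>a n\<bar> * \<bar>cos (2 * pi * real n * (1/4))\<bar> \<le> \<bar>a n\<bar> * real n"
      by (intro mult_left_mono order.trans[OF abs_cos_le_one]) (use \<open>n \<ge> 1\<close> in auto)
    then show "norm (a n * cos (2 * pi * real n * (1/4))) \<le> \<bar>a n\<bar> * real n"
      by (simp add: abs_mult)
  qed
qed auto

lemma DERIV_sin_series:
  fixes a :: "nat \<Rightarrow> real"
  assumes "summable (\<lambda>n. \<bar>a n\<bar> * real n)"
  shows "((\<lambda>x. suminf (\<lambda>n. a n * sin (2 * pi * real n * x))) has_field_derivative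
          suminf (\<lambda>n. 2 * pi * (a n * real n) * cos (2 * pi * real n * x))) (at x)"
proof (rule has_field_derivative_series'(2)[where S = UNIV and ?x0.0 = 0])
  show "((\<lambda>x. a n * sin (2 * pi * real n * x)) has_field_derivative
          2 * pi * (a n * real n) * cos (2 * pi * real n * x)) (at x)" for n x
    by (auto intro!: derivative_eq_intros simp: algebra_simps)
  have "summable (\<lambda>n. 2 * pi * (\<bar>a n\<bar> * real n))"
    by (intro summable_mult assms)
  then show "uniformly_convergent_on UNIV
      (\<lambda>n x. \<Sum>i<n. 2 * pi * (a i * real i) * cos (2 * pi * real i * x))"
    by (rule Weierstrass_m_test'[rotated])
       (auto simp: abs_mult intro!: mult_left_mono mult_left_le)
qed auto

section \<open>Closed forms of the cosine sums with exponents 2 and 4\<close>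

lemma summable_inverse_power: "s \<ge> 2 \<Longrightarrow> summable (\<lambda>n. 1 / real n ^ s)"
  using inverse_power_summable[of s, where 'a = real] by (simp add: field_simps)

lemma summable_cos_over_power:
  "s \<ge> 2 \<Longrightarrow> summable (\<lambda>n. cos (2 * pi * real n * x) / real n ^ s)"
  by (rule summable_comparison_test'[OF summable_inverse_power[of s], of 0])
     (auto simp: divide_right_mono)

text \<open>The real part of the polylogarithm of order \<open>s\<close> at
  \<open>cis (2 * pi * x)\<close>. For \<open>s > 0\<close> the term \<open>n = 0\<close> is 0, by
  the convention for division by zero.\<close>

definition cos_sum :: "nat \<Rightarrow> real \<Rightarrow> real" where
  "cos_sum s x = suminf (\<lambda>n. cos (2 * pi * real n * x) / real n ^ s)"

lemma cos_sum_sums: "s \<ge> 2 \<Longrightarrow> (\<lambda>n. cos (2 * pi * real n * x) / real n ^ s) sums cos_sum s x"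
  unfolding cos_sum_def by (intro summable_sums summable_cos_over_power)

lemma cos_sum_minus: "cos_sum s (- x) = cos_sum s x"
  by (simp add: cos_sum_def)

lemma continuous_cos_sum: "s \<ge> 2 \<Longrightarrow> continuous_on UNIV (cos_sum s)"
proof -
  assume "s \<ge> 2"
  have "uniform_limit UNIV (\<lambda>n x. \<Sum>i<n. cos (2 * pi * real i * x) / real i ^ s)
          (cos_sum s) sequentially"
    unfolding cos_sum_def
    by (rule Weierstrass_m_test[OF _ summable_inverse_power[OF \<open>s \<ge> 2\<close>]]) (auto simp: divide_right_mono)
  then show ?thesis
    by (rule uniform_limit_theorem[rotated])
       (auto intro!: always_eventually continuous_intros simp: divide_inverse)
qed

text \<open>Half-angle factorisation: \<open>1 - cis (2 * pi * u)\<close> is the positive number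
  \<open>2 * sin (pi * u)\<close> times \<open>cis (pi * (u - 1/2))\<close>, whose angle lies in the
  principal range.\<close>

lemma Im_Ln_one_minus_cis:
  assumes "0 < u" "u < 1"
  shows "Im (Ln (1 - cis (2 * pi * u))) = pi * (u - 1/2)"
proof -
  have s: "sin (pi * u) > 0"
    using assms by (intro sin_gt_zero) auto
  have "cos (2 * (pi * u)) = 1 - 2 * (sin (pi * u))\<^sup>2" "sin (2 * (pi * u)) = 2 * sin (pi * u) * cos (pi * u)"
    by (simp_all add: cos_double_sin sin_double)
  moreover have "cos (pi * (u - 1/2)) = sin (pi * u)" "sin (pi * (u - 1/2)) = - cos (pi * u)"
    by (simp_all add: right_diff_distrib cos_diff sin_diff)
  ultimately have *: "1 - cis (2 * pi * u) = of_real (2 * sin (pi * u)) * cis (pi * (u - 1/2))"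
    by (simp add: complex_eq_iff power2_eq_square mult_ac)
  have "0 < pi * u" "pi * u < pi * 1"
    using assms by (simp, intro mult_strict_left_mono) auto
  then have "Arg (1 - cis (2 * pi * u)) = pi * (u - 1/2)"
    using s assms unfolding *
    by (intro Arg_unique[where r = "2 * sin (pi * u)"]) (auto simp: cis_conv_exp algebra_simps intro: less_trans[of _ 0])
  moreover have "1 - cis (2 * pi * u) \<noteq> 0"
    using s unfolding * by auto
  ultimately show ?thesis
    by (simp add: Arg_eq_Im_Ln)
qed

text \<open>Abel summation: inside the disc the derivative of the damped series is
  \<open>2 * pi * Im (Ln (1 - r * cis (2 * pi * u)))\<close>, and the latter converges boundedly as \<open>r\<close> tends to 1.\<close>

lemma cos_sum_2_left_half:
  assumes "0 < x" "x \<le> 1/2"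
  shows "cos_sum 2 x = cos_sum 2 (1/2) + pi\<^sup>2 * (x - 1/2)\<^sup>2"
proof -
  define r :: "nat \<Rightarrow> real" where "r m = 1 - 1 / (real m + 2)" for m
  have r: "0 < r m" "r m < 1" for m
    by (auto simp: r_def field_simps)
  have r_lim: "r \<longlonglongrightarrow> 1"
    unfolding r_def by real_asymp
  define G where "G m u = suminf (\<lambda>n. (r m ^ n / real n ^ 2) * cos (2 * pi * real n * u))" for m u
  define F where "F m u = 2 * pi * Im (Ln (1 - of_real (r m) * cis (2 * pi * u)))" for m u
  have F_sum: "suminf (\<lambda>n. - (2 * pi * (r m ^ n / real n ^ 2 * real n) * sin (2 * pi * real n * u))) = F m u"
    for m u
  proof -
    have "(\<lambda>n. - ((of_real (r m) * cis (2 * pi * u)) ^ n) / of_nat n) sums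
            Ln (1 + - (of_real (r m) * cis (2 * pi * u)))"
      using Ln_series'[of "- (of_real (r m) * cis (2 * pi * u))"] r[of m] by (simp add: norm_mult)
    then have "(\<lambda>n. 2 * pi * Im (- ((of_real (r m) * cis (2 * pi * u)) ^ n) / of_nat n)) sums F m u"
      unfolding F_def by (intro sums_mult sums_Im) simp
    moreover have "Im (- ((of_real (r m) * cis (2 * pi * u)) ^ n) / of_nat n)
        = - (r m ^ n / real n ^ 2 * real n * sin (2 * pi * real n * u))" for n
    proof -
      have "(of_real (r m) * cis (2 * pi * u)) ^ n = of_real (r m ^ n) * cis (2 * pi * real n * u)"
        by (simp only: power_mult_distrib Complex.DeMoivre of_real_power mult.assoc mult.left_commute)
      then show ?thesis
        by (simp add: power2_eq_square Im_divide_of_nat)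
    qed
    ultimately have "(\<lambda>n. 2 * pi * - (r m ^ n / real n ^ 2 * real n * sin (2 * pi * real n * u))) sums F m u"
      by (simp only:)
    from sums_unique[OF this] show ?thesis
      by (simp add: mult.assoc)
  qed
  have G_deriv: "(G m has_field_derivative F m u) (at u)" for m u
  proof -
    \<comment> \<open>The damping factor makes the differentiated series geometric; at
      \<open>r = 1\<close> it would not converge absolutely.\<close>
    have "summable (\<lambda>n. \<bar>r m ^ n / real n ^ 2\<bar> * real n)"
    proof (rule summable_comparison_test'[OF summable_geometric[of "r m"], of 0])
      show "norm (r m) < 1" using r[of m] by simp
      fix n :: nat
      show "norm (\<bar>r m ^ n / real n ^ 2\<bar> * real n) \<le> r m ^ n"
        using r[of m] by (cases "n = 0") (auto simp: field_simps power2_eq_square)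
    qed
    from DERIV_cos_series[OF this, of u] show ?thesis
      unfolding F_sum unfolding G_def .
  qed
  have G_lim: "(\<lambda>m. G m u) \<longlonglongrightarrow> cos_sum 2 u" for u
  proof -
    have "eventually (\<lambda>m. summable (\<lambda>n. norm ((r m ^ n / real n ^ 2) * cos (2 * pi * real n * u)))) sequentially
      \<and> summable (\<lambda>n. norm (cos (2 * pi * real n * u) / real n ^ 2)) \<and>
      ((\<lambda>m. suminf (\<lambda>n. (r m ^ n / real n ^ 2) * cos (2 * pi * real n * u))) \<longlongrightarrow>
         suminf (\<lambda>n. cos (2 * pi * real n * u) / real n ^ 2)) sequentially"
    proof (rule tannerys_theorem[OF _ _ summable_inverse_power[of 2]])
      fix n :: nat
      have "(\<lambda>m. r m ^ n * (cos (2 * pi * real n * u) / real n ^ 2)) \<longlonglongrightarrow>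
            1 ^ n * (cos (2 * pi * real n * u) / real n ^ 2)"
        by (intro tendsto_mult tendsto_power r_lim tendsto_const)
      then show "(\<lambda>m. (r m ^ n / real n ^ 2) * cos (2 * pi * real n * u)) \<longlonglongrightarrow>
            cos (2 * pi * real n * u) / real n ^ 2" by simp
    next
      have "norm ((r m ^ n / real n ^ 2) * cos (2 * pi * real n * u)) \<le> 1 / real n ^ 2" for n m
      proof -
        have "r m ^ n * \<bar>cos (2 * pi * real n * u)\<bar> \<le> 1 * 1"
          using r[of m] by (intro mult_mono power_le_one) auto
        then show ?thesis
          using r[of m] by (simp add: abs_mult divide_right_mono)
      qed
      then show "\<forall>\<^sub>F (n, m) in sequentially \<times>\<^sub>F sequentially.
           norm ((r m ^ n / real n ^ 2) * cos (2 * pi * real n * u)) \<le> 1 / real n ^ 2"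
        by (intro always_eventually) auto
    qed auto
    then show ?thesis
      unfolding G_def cos_sum_def by simp
  qed
  \<comment> \<open>Dominated convergence carries the fundamental theorem for the damped series to
    the limit; the bound comes from the range of the imaginary part of \<open>Ln\<close>.\<close>
  have "((\<lambda>u. 2 * pi * (pi * (u - 1/2))) has_integral (cos_sum 2 (1/2) - cos_sum 2 x)) {x..1/2}"
  proof (rule has_integral_dominated_convergence)
    show "(F m has_integral (G m (1/2) - G m x)) {x..1/2}" for m
      by (rule fundamental_theorem_of_calculus)
         (use assms in \<open>auto intro!: has_field_derivative_at_within G_deriv
            simp: has_real_derivative_iff_has_vector_derivative[symmetric]\<close>)
    show "(\<lambda>_. 2 * pi * pi) integrable_on {x..1/2}"
      by (intro integrable_const_ivl)
    show "\<forall>u\<in>{x..1/2}. norm (F m u) \<le> 2 * pi * pi" for m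
    proof
      fix u
      have "cmod (of_real (r m) * cis (2 * pi * u)) < 1"
        using r[of m] by (simp add: norm_mult)
      then have "1 - of_real (r m) * cis (2 * pi * u) \<noteq> 0"
        by auto
      then have "\<bar>Im (Ln (1 - of_real (r m) * cis (2 * pi * u)))\<bar> \<le> pi"
        using mpi_less_Im_Ln Im_Ln_le_pi by (intro abs_leI) (auto simp: less_imp_le minus_le_iff)
      then show "norm (F m u) \<le> 2 * pi * pi"
        unfolding F_def by (simp add: abs_mult)
    qed
    show "\<forall>u\<in>{x..1/2}. (\<lambda>m. F m u) \<longlonglongrightarrow> 2 * pi * (pi * (u - 1/2))"
    proof
      fix u assume u: "u \<in> {x..1/2}"
      then have u': "0 < u" "u < 1" using assms by auto
      \<comment> \<open>This keeps \<open>1 - cis (2 * pi * u)\<close> off the branch cut, so that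
        \<open>Ln\<close> is continuous there. The restriction to u \<le> 1/2 places the angle in
        the range where cosine decreases.\<close>
      have "cos (2 * pi * u) < cos 0"
        using u' u by (intro cos_monotone_0_pi) auto
      then have "1 - cis (2 * pi * u) \<notin> \<real>\<^sub>\<le>\<^sub>0"
        by (auto simp: complex_nonpos_Reals_iff)
      then have "(\<lambda>m. F m u) \<longlonglongrightarrow> 2 * pi * Im (Ln (1 - of_real 1 * cis (2 * pi * u)))"
        unfolding F_def by (intro tendsto_intros r_lim) simp
      then show "(\<lambda>m. F m u) \<longlonglongrightarrow> 2 * pi * (pi * (u - 1/2))"
        using Im_Ln_one_minus_cis[OF u'] by simp
    qed
    show "(\<lambda>m. G m (1/2) - G m x) \<longlonglongrightarrow> cos_sum 2 (1/2) - cos_sum 2 x"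
      by (intro tendsto_intros G_lim)
  qed
  moreover have "((\<lambda>u. 2 * pi * (pi * (u - 1/2))) has_integral
      (pi\<^sup>2 * (1/2 - 1/2)\<^sup>2 - pi\<^sup>2 * (x - 1/2)\<^sup>2)) {x..1/2}"
    by (rule fundamental_theorem_of_calculus)
       (use assms in \<open>auto intro!: derivative_eq_intros
          simp: has_real_derivative_iff_has_vector_derivative[symmetric] power2_eq_square algebra_simps\<close>)
  ultimately have "cos_sum 2 (1/2) - cos_sum 2 x = pi\<^sup>2 * (1/2 - 1/2)\<^sup>2 - pi\<^sup>2 * (x - 1/2)\<^sup>2"
    by (rule has_integral_unique)
  then show ?thesis by simp
qed


lemma cos_sum_one_minus: "cos_sum s (1 - x) = cos_sum s x"
proof -
  have "cos (2 * pi * real n * (1 - x)) = cos (2 * pi * real n * x)" for n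
  proof -
    have "cos (2 * pi * real n * (1 - x)) = cos (2 * pi * real n * x - 2 * pi * real n)"
      by (subst cos_minus[symmetric]) (simp add: algebra_simps)
    also have "\<dots> = cos (2 * pi * real n * x)"
      using cos_2npi[of n] sin_2npi[of n] by (simp add: cos_diff mult_ac)
    finally show ?thesis .
  qed
  then show ?thesis by (simp only: cos_sum_def)
qed

text \<open>Continuity adds the endpoint 0 to the half-interval formula, the reflection
  \<open>1 - x\<close> gives the other half, and evenness the negative side. The value at 0 stays
  symbolic, since fourth differences cancel it later.\<close>

lemma cos_sum_2:
  assumes "\<bar>x\<bar> \<le> 1"
  shows "cos_sum 2 x = cos_sum 2 0 + pi\<^sup>2 * (x\<^sup>2 - \<bar>x\<bar>)"
proof -
  have half: "cos_sum 2 y = cos_sum 2 (1/2) + pi\<^sup>2 * (y - 1/2)\<^sup>2" if "y \<in> {0..1/2}" for y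
  proof -
    have "closed {y. cos_sum 2 y = cos_sum 2 (1/2) + pi\<^sup>2 * (y - 1/2)\<^sup>2}"
      by (intro closed_Collect_eq continuous_intros continuous_cos_sum) auto
    then have "closure {0<..1/2} \<subseteq> {y. cos_sum 2 y = cos_sum 2 (1/2) + pi\<^sup>2 * (y - 1/2)\<^sup>2}"
      by (rule closure_minimal[rotated]) (auto intro: cos_sum_2_left_half)
    with that show ?thesis by auto
  qed
  have whole: "cos_sum 2 y = cos_sum 2 0 + pi\<^sup>2 * (y\<^sup>2 - y)" if "y \<in> {0..1}" for y
  proof -
    have "cos_sum 2 y = cos_sum 2 (1/2) + pi\<^sup>2 * (y - 1/2)\<^sup>2"
    proof (cases "y \<le> 1/2")
      case True
      then show ?thesis using half[of y] that by auto
    next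
      case False
      then have "cos_sum 2 (1 - y) = cos_sum 2 (1/2) + pi\<^sup>2 * (1 - y - 1/2)\<^sup>2"
        using that by (intro half) auto
      then show ?thesis
        by (simp add: cos_sum_one_minus power2_eq_square algebra_simps)
    qed
    then show ?thesis
      using half[of 0] by (simp add: power2_eq_square algebra_simps)
  qed
  from whole[of "\<bar>x\<bar>"] assms show ?thesis
    by (cases "x \<ge> 0") (auto simp: cos_sum_minus)
qed

text \<open>Integrates \<open>cos_sum 2\<close> twice: the sine series \<open>S\<close> of exponent
  3 has derivative \<open>2 * pi * cos_sum 2\<close>, and \<open>cos_sum 4\<close> has derivative
  \<open>- 2 * pi * S\<close>. The constants are fixed by the values at 0.\<close>

lemma cos_sum_4:
  assumes "\<bar>x\<bar> \<le> 1"
  shows "cos_sum 4 x = cos_sum 4 0 - pi ^ 4 / 3 * (x ^ 4 - 2 * \<bar>x\<bar> ^ 3) - 2 * pi\<^sup>2 * cos_sum 2 0 * x\<^sup>2"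
proof -
  define \<beta> where "\<beta> = cos_sum 2 0"
  define S where "S x = suminf (\<lambda>n. (1 / real n ^ 3) * sin (2 * pi * real n * x))" for x
  have eq3: "1 / real n ^ 3 * real n = 1 / real n ^ 2" and eq4: "1 / real n ^ 4 * real n = 1 / real n ^ 3" for n
    by (auto simp: power2_eq_square power3_eq_cube power4_eq_xxxx)
  have "summable (\<lambda>n. \<bar>1 / real n ^ 3\<bar> * real n)"
    using summable_inverse_power[of 2] by (simp only: abs_divide abs_one abs_of_nat power_abs eq3)
  then have S_deriv: "(S has_field_derivative 2 * pi * cos_sum 2 y) (at y)" for y
  proof -
    have "suminf (\<lambda>n. 2 * pi * (1 / real n ^ 3 * real n) * cos (2 * pi * real n * y)) = 2 * pi * cos_sum 2 y"
      unfolding eq3 cos_sum_def using suminf_mult[OF summable_cos_over_power[of 2 y], of "2 * pi"]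
      by (simp add: mult.assoc)
    with DERIV_sin_series[OF \<open>summable (\<lambda>n. \<bar>1 / real n ^ 3\<bar> * real n)\<close>, of y]
    show ?thesis by (simp add: S_def[abs_def])
  qed
  have "summable (\<lambda>n. \<bar>1 / real n ^ 4\<bar> * real n)"
    using summable_inverse_power[of 3] by (simp only: abs_divide abs_one abs_of_nat power_abs eq4)
  then have C_deriv: "(cos_sum 4 has_field_derivative - (2 * pi * S y)) (at y)" for y
  proof -
    have s: "summable (\<lambda>n. (1 / real n ^ 3) * sin (2 * pi * real n * y))"
      by (rule summable_comparison_test'[OF summable_inverse_power[of 3], of 0])
         (auto simp: divide_right_mono)
    have "suminf (\<lambda>n. - (2 * pi * (1 / real n ^ 4 * real n) * sin (2 * pi * real n * y))) = - (2 * pi * S y)"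
      unfolding eq4 S_def using suminf_mult[OF s, of "- (2 * pi)"] by (simp add: mult.assoc)
    with DERIV_cos_series[OF \<open>summable (\<lambda>n. \<bar>1 / real n ^ 4\<bar> * real n)\<close>, of y]
    show ?thesis by (simp add: cos_sum_def[abs_def])
  qed
  have S_eq: "S y = pi ^ 3 / 6 * (4 * y ^ 3 - 6 * y\<^sup>2) + 2 * pi * \<beta> * y" if "y \<in> {0..1}" for y
  proof -
    have "\<exists>c. \<forall>y\<in>{0..1}. S y - (pi ^ 3 / 6 * (4 * y ^ 3 - 6 * y\<^sup>2) + 2 * pi * \<beta> * y) = c"
    proof (rule has_field_derivative_zero_constant)
      fix z :: real assume z: "z \<in> {0..1}"
      have "((\<lambda>y. S y - (pi ^ 3 / 6 * (4 * y ^ 3 - 6 * y\<^sup>2) + 2 * pi * \<beta> * y)) has_field_derivative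
         2 * pi * cos_sum 2 z - (pi ^ 3 / 6 * (12 * z\<^sup>2 - 12 * z) + 2 * pi * \<beta>)) (at z)"
        by (auto intro!: derivative_eq_intros S_deriv simp: algebra_simps)
      also have "2 * pi * cos_sum 2 z - (pi ^ 3 / 6 * (12 * z\<^sup>2 - 12 * z) + 2 * pi * \<beta>) = 0"
      proof -
        have "cos_sum 2 z = \<beta> + pi\<^sup>2 * (z\<^sup>2 - z)"
          using cos_sum_2[of z] z by (simp add: \<beta>_def)
        then show ?thesis
          by (simp only:) (simp add: power2_eq_square power3_eq_cube algebra_simps)
      qed
      finally show "((\<lambda>y. S y - (pi ^ 3 / 6 * (4 * y ^ 3 - 6 * y\<^sup>2) + 2 * pi * \<beta> * y)) has_field_derivative 0)
          (at z within {0..1})"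
        by (rule has_field_derivative_at_within)
    qed auto
    then obtain c where c: "\<And>y. y \<in> {0..1} \<Longrightarrow> S y - (pi ^ 3 / 6 * (4 * y ^ 3 - 6 * y\<^sup>2) + 2 * pi * \<beta> * y) = c"
      by blast
    have "S 0 = 0" by (simp add: S_def)
    with c[of 0] c[OF that] show ?thesis by simp
  qed
  have C_eq: "cos_sum 4 y = cos_sum 4 0 - pi ^ 4 / 3 * (y ^ 4 - 2 * y ^ 3) - 2 * pi\<^sup>2 * \<beta> * y\<^sup>2"
    if "y \<in> {0..1}" for y
  proof -
    have "\<exists>c. \<forall>y\<in>{0..1}. cos_sum 4 y + pi ^ 4 / 3 * (y ^ 4 - 2 * y ^ 3) + 2 * pi\<^sup>2 * \<beta> * y\<^sup>2 = c"
    proof (rule has_field_derivative_zero_constant)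
      fix z :: real assume z: "z \<in> {0..1}"
      have "((\<lambda>y. cos_sum 4 y + pi ^ 4 / 3 * (y ^ 4 - 2 * y ^ 3) + 2 * pi\<^sup>2 * \<beta> * y\<^sup>2) has_field_derivative
         - (2 * pi * S z) + pi ^ 4 / 3 * (4 * z ^ 3 - 6 * z\<^sup>2) + 4 * pi\<^sup>2 * \<beta> * z) (at z)"
        by (auto intro!: derivative_eq_intros C_deriv simp: algebra_simps)
      also have "- (2 * pi * S z) + pi ^ 4 / 3 * (4 * z ^ 3 - 6 * z\<^sup>2) + 4 * pi\<^sup>2 * \<beta> * z = 0"
        unfolding S_eq[OF z] by (simp add: power2_eq_square power3_eq_cube power4_eq_xxxx algebra_simps)
      finally show "((\<lambda>y. cos_sum 4 y + pi ^ 4 / 3 * (y ^ 4 - 2 * y ^ 3) + 2 * pi\<^sup>2 * \<beta> * y\<^sup>2) has_field_derivative 0)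
          (at z within {0..1})"
        by (rule has_field_derivative_at_within)
    qed auto
    then obtain c where c: "\<And>y. y \<in> {0..1} \<Longrightarrow>
        cos_sum 4 y + pi ^ 4 / 3 * (y ^ 4 - 2 * y ^ 3) + 2 * pi\<^sup>2 * \<beta> * y\<^sup>2 = c"
      by blast
    with c[of 0] c[OF that] show ?thesis by simp
  qed
  have "cos_sum 4 \<bar>x\<bar> = cos_sum 4 x"
    by (cases "x \<ge> 0") (auto simp: cos_sum_minus)
  with C_eq[of "\<bar>x\<bar>"] assms show ?thesis
    by (simp add: \<beta>_def power_even_abs)
qed

text \<open>The terms at \<open>k\<close> and \<open>- k\<close> add up to twice a cosine. Index 0
  belongs to both halves, and \<open>g 0 = 0\<close> prevents it from being counted twice.\<close>

lemma has_sum_even_cis: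
  fixes g :: "nat \<Rightarrow> real"
  assumes summ: "summable (\<lambda>n. \<bar>g n\<bar>)" and g0: "g 0 = 0"
    and s: "(\<lambda>n. g n * cos (2 * pi * real n * x)) sums s"
  shows "((\<lambda>k::int. of_real (g (nat \<bar>k\<bar>)) * cis (2 * pi * of_int k * x)) has_sum of_real (2 * s)) UNIV"
proof -
  define F where "F k = of_real (g (nat \<bar>k\<bar>)) * cis (2 * pi * of_int k * x)" for k :: int
  have abs: "(\<lambda>n. norm (F (int n))) summable_on UNIV" "(\<lambda>n. norm (F (- int n))) summable_on UNIV"
  proof -
    have "norm (F (int n)) = \<bar>g n\<bar>" "norm (F (- int n)) = \<bar>g n\<bar>" for n
      by (simp_all add: F_def norm_mult)
    moreover have "(\<lambda>n. \<bar>g n\<bar>) summable_on UNIV"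
      by (intro summable_nonneg_imp_summable_on summ) simp
    ultimately show "(\<lambda>n. norm (F (int n))) summable_on UNIV" "(\<lambda>n. norm (F (- int n))) summable_on UNIV"
      by (simp_all only:)
  qed
  from abs(1)[THEN abs_summable_summable] obtain P where P: "((\<lambda>n. F (int n)) has_sum P) UNIV"
    unfolding summable_on_def by blast
  from abs(2)[THEN abs_summable_summable] obtain Q where Q: "((\<lambda>n. F (- int n)) has_sum Q) UNIV"
    unfolding summable_on_def by blast
  have "((\<lambda>n. F (int n) + F (- int n)) has_sum (P + Q)) UNIV"
    by (intro has_sum_add P Q)
  moreover have "F (int n) + F (- int n) = of_real (2 * (g n * cos (2 * pi * real n * x)))" for n
    by (simp add: F_def complex_eq_iff)
  moreover have "((\<lambda>n. of_real (2 * (g n * cos (2 * pi * real n * x)))) has_sum (of_real (2 * s) :: complex)) UNIV"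
  proof (intro norm_summable_imp_has_sum sums_of_real sums_mult s)
    have "summable (\<lambda>n. \<bar>g n * cos (2 * pi * real n * x)\<bar>)"
      by (rule summable_comparison_test'[OF summ, of 0]) (auto simp: abs_mult mult_left_le)
    then have "summable (\<lambda>n. 2 * \<bar>g n * cos (2 * pi * real n * x)\<bar>)"
      by (rule summable_mult)
    then show "summable (\<lambda>n. norm (of_real (2 * (g n * cos (2 * pi * real n * x))) :: complex))"
      by (simp add: norm_mult abs_mult)
  qed
  ultimately have PQ: "P + Q = of_real (2 * s)"
    by (simp add: has_sum_unique)
  have F0: "F 0 = 0" by (simp add: F_def g0)
  have "((F \<circ> int) has_sum P) {1..}"
    using P by (subst has_sum_cong_neutral[where T = UNIV and g = "F \<circ> int"]) (auto simp: F0 o_def not_le)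
  then have 1: "(F has_sum P) (int ` {1..})"
    by (subst has_sum_reindex) auto
  have "((F \<circ> (\<lambda>n. - int n)) has_sum Q) {1..}"
    using Q by (subst has_sum_cong_neutral[where T = UNIV and g = "F \<circ> (\<lambda>n. - int n)"]) (auto simp: F0 o_def not_le)
  then have 2: "(F has_sum Q) ((\<lambda>n. - int n) ` {1..})"
    by (subst has_sum_reindex) (auto simp: inj_on_def)
  have "(F has_sum (P + Q)) (int ` {1..} \<union> (\<lambda>n. - int n) ` {1..})"
    by (intro has_sum_Un_disjoint 1 2) auto
  moreover have "F k = 0" if "k \<notin> int ` {1..} \<union> (\<lambda>n. - int n) ` {1..}" for k
  proof -
    have "k = 0"
    proof (rule ccontr)
      assume "k \<noteq> 0"
      then have "k = int (nat \<bar>k\<bar>) \<or> k = - int (nat \<bar>k\<bar>)" "nat \<bar>k\<bar> \<in> {1..}" by auto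
      with that show False by blast
    qed
    then show ?thesis by (simp add: F0)
  qed
  ultimately have "(F has_sum (P + Q)) UNIV"
    by (subst has_sum_cong_neutral[where T = "int ` {1..} \<union> (\<lambda>n. - int n) ` {1..}" and g = F]) auto
  then show ?thesis
    unfolding F_def PQ .
qed

section \<open>Fourth differences and cubic splines\<close>

text \<open>The fourth central difference with step \<open>a\<close>. The divisor 8 makes it
  multiply the frequency \<open>n\<close> by \<open>2 * sin (pi * n * a) ^ 4\<close>, the 2
  accounting for the pair of exponentials in a cosine.\<close>

definition central_diff4 :: "(real \<Rightarrow> real) \<Rightarrow> real \<Rightarrow> real \<Rightarrow> real" where
  "central_diff4 F a x = (6 * F x - 4 * F (x - a) - 4 * F (x + a) + F (x - 2 * a) + F (x + 2 * a)) / 8"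

text \<open>Applied with \<open>y = pi * n * a\<close> and \<open>z = 2 * pi * n * x\<close>, where
  shifting \<open>x\<close> by \<open>a\<close> shifts \<open>z\<close> by \<open>2 * y\<close>:
  cosines are eigenfunctions of the fourth difference.\<close>

lemma sin_power4_times_cos:
  fixes y z :: real
  shows "sin y ^ 4 * cos z =
    (6 * cos z - 4 * cos (z - 2 * y) - 4 * cos (z + 2 * y) + cos (z - 4 * y) + cos (z + 4 * y)) / 16"
proof -
  define s where "s = (sin y)\<^sup>2"
  have c2: "cos (2 * y) = 1 - 2 * s"
    by (simp add: s_def cos_double_sin)
  have "cos (4 * y) = 2 * (cos (2 * y))\<^sup>2 - 1"
    using cos_double_cos[of "2 * y"] by simp
  then have c4: "cos (4 * y) = 2 * (1 - 2 * s)\<^sup>2 - 1"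
    by (simp only: c2)
  have "(6 * cos z - 4 * cos (z - 2 * y) - 4 * cos (z + 2 * y) + cos (z - 4 * y) + cos (z + 4 * y))
      = cos z * (6 - 8 * cos (2 * y) + 2 * cos (4 * y))"
    by (simp add: cos_add cos_diff algebra_simps)
  also have "\<dots> = 16 * (s\<^sup>2 * cos z)"
    unfolding c2 c4 by (simp add: power2_eq_square algebra_simps)
  finally show ?thesis
    by (simp add: s_def flip: power_mult)
qed

lemma sin_power4_series_sums:
  assumes "s \<ge> 2"
  shows "(\<lambda>n. sin (pi * real n * a) ^ 4 / real n ^ s * cos (2 * pi * real n * x)) sums
           (central_diff4 (cos_sum s) a x / 2)"
proof -
  let ?c = "\<lambda>y n. cos (2 * pi * real n * y) / real n ^ s"
  have "(\<lambda>n. (6 * ?c x n - 4 * ?c (x - a) n - 4 * ?c (x + a) n + ?c (x - 2 * a) n + ?c (x + 2 * a) n) / 16)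
     sums ((6 * cos_sum s x - 4 * cos_sum s (x - a) - 4 * cos_sum s (x + a)
       + cos_sum s (x - 2 * a) + cos_sum s (x + 2 * a)) / 16)"
    by (intro sums_divide sums_add sums_diff sums_mult cos_sum_sums assms)
  moreover have "(6 * ?c x n - 4 * ?c (x - a) n - 4 * ?c (x + a) n + ?c (x - 2 * a) n + ?c (x + 2 * a) n) / 16
      = sin (pi * real n * a) ^ 4 / real n ^ s * cos (2 * pi * real n * x)" for n
  proof -
    have "sin (pi * real n * a) ^ 4 * cos (2 * pi * real n * x) =
      (6 * cos (2 * pi * real n * x) - 4 * cos (2 * pi * real n * (x - a)) - 4 * cos (2 * pi * real n * (x + a))
        + cos (2 * pi * real n * (x - 2 * a)) + cos (2 * pi * real n * (x + 2 * a))) / 16"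
      unfolding sin_power4_times_cos by (simp add: algebra_simps)
    then have "sin (pi * real n * a) ^ 4 * cos (2 * pi * real n * x) / real n ^ s =
      (6 * cos (2 * pi * real n * x) - 4 * cos (2 * pi * real n * (x - a)) - 4 * cos (2 * pi * real n * (x + a))
        + cos (2 * pi * real n * (x - 2 * a)) + cos (2 * pi * real n * (x + 2 * a))) / 16 / real n ^ s"
      by (simp only:)
    then show ?thesis
      by (simp add: add_divide_distrib diff_divide_distrib mult.commute)
  qed
  ultimately show ?thesis
    by (simp add: central_diff4_def)
qed

lemma has_sum_sin_power4:
  assumes "s \<ge> 2"
  shows "((\<lambda>k::int. of_real (sin (pi * \<bar>real_of_int k\<bar> * a) ^ 4 / \<bar>real_of_int k\<bar> ^ s) * cis (2 * pi * of_int k * x))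
     has_sum of_real (central_diff4 (cos_sum s) a x)) UNIV"
proof -
  have "\<bar>sin y ^ 4\<bar> \<le> 1" for y :: real
    using power_le_one[of "\<bar>sin y\<bar>" 4] by (simp add: power_abs)
  then have "summable (\<lambda>n. \<bar>sin (pi * real n * a) ^ 4 / real n ^ s\<bar>)"
    using assms by (intro summable_comparison_test'[OF summable_inverse_power[of s], of 0])
      (auto simp: divide_right_mono)
  then have "((\<lambda>k::int. of_real (sin (pi * real (nat \<bar>k\<bar>) * a) ^ 4 / real (nat \<bar>k\<bar>) ^ s) * cis (2 * pi * of_int k * x))
     has_sum of_real (2 * (central_diff4 (cos_sum s) a x / 2))) UNIV"
    by (rule has_sum_even_cis) (use sin_power4_series_sums[OF assms] in auto)
  then show ?thesis by simp
qed

text \<open>Up to normalisation, the Fourier coefficients of a periodised cubic B-spline supported in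
  \<open>[-2a, 2a]\<close>, that is, of the convolution square of a tent function.\<close>

definition spline_coeff :: "real \<Rightarrow> int \<Rightarrow> real" where
  "spline_coeff a k = (if k = 0 then (pi * a) ^ 4 else sin (pi * of_int k * a) ^ 4 / of_int k ^ 4)"

text \<open>The added constant is the Fourier coefficient at \<open>k = 0\<close>, which a cosine
  sum cannot supply.\<close>

definition spline :: "real \<Rightarrow> real \<Rightarrow> real" where
  "spline a x = (pi * a) ^ 4 + central_diff4 (cos_sum 4) a x"

text \<open>The second derivative of \<open>spline a\<close> divided by \<open>- 4 * pi\<^sup>2\<close>.\<close>

definition spline'' :: "real \<Rightarrow> real \<Rightarrow> real" where
  "spline'' a x = central_diff4 (cos_sum 2) a x"

lemma spline_coeff_nonneg: "spline_coeff a k \<ge> 0"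
  by (simp add: spline_coeff_def)

lemma sin_power4_abs: "sin (pi * \<bar>real_of_int k\<bar> * a) ^ 4 = sin (pi * of_int k * a) ^ 4"
  by (cases "k \<ge> 0") auto

lemma has_sum_spline:
  "((\<lambda>k. of_real (spline_coeff a k) * cis (2 * pi * of_int k * x)) has_sum of_real (spline a x)) UNIV"
proof -
  have "((\<lambda>k::int. if k = 0 then (of_real ((pi * a) ^ 4) :: complex) else 0) has_sum of_real ((pi * a) ^ 4)) UNIV"
    by (rule has_sum_finite_neutralI[where B = "{0}"]) auto
  from has_sum_add[OF this has_sum_sin_power4[of 4 a x]]
  have "((\<lambda>k::int. (if k = 0 then of_real ((pi * a) ^ 4) else 0) +
      of_real (sin (pi * of_int k * a) ^ 4 / \<bar>real_of_int k\<bar> ^ 4) * cis (2 * pi * of_int k * x))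
      has_sum of_real (spline a x)) UNIV"
    by (simp add: sin_power4_abs spline_def)
  moreover have "(if k = 0 then of_real ((pi * a) ^ 4) else 0) +
      of_real (sin (pi * of_int k * a) ^ 4 / \<bar>real_of_int k\<bar> ^ 4) * cis (2 * pi * of_int k * x)
    = of_real (spline_coeff a k) * cis (2 * pi * of_int k * x)" for k
    by (simp add: spline_coeff_def power_even_abs)
  ultimately show ?thesis by (simp only:)
qed

lemma has_sum_spline'':
  "((\<lambda>k. of_real ((of_int k)\<^sup>2 * spline_coeff a k) * cis (2 * pi * of_int k * x)) has_sum of_real (spline'' a x)) UNIV"
proof -
  have "sin (pi * of_int k * a) ^ 4 / \<bar>real_of_int k\<bar> ^ 2 = (of_int k)\<^sup>2 * spline_coeff a k" for k
    by (simp add: spline_coeff_def power_even_abs power2_eq_square power4_eq_xxxx)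
  then show ?thesis
    using has_sum_sin_power4[of 2 a x, OF order.refl] unfolding sin_power4_abs spline''_def by (simp only:)
qed

text \<open>Fourth differences annihilate cubics and send the monomial of degree 4 to
  \<open>24 * a ^ 4\<close>; the divisor 8 leaves 3.\<close>

lemma central_diff4_quartic:
  fixes c0 c1 c2 c3 c4 :: real
  assumes "\<And>y. y \<in> {x, x - a, x + a, x - 2 * a, x + 2 * a} \<Longrightarrow> F y = c0 + c1 * y + c2 * y\<^sup>2 + c3 * y ^ 3 + c4 * y ^ 4"
  shows "central_diff4 F a x = 3 * c4 * a ^ 4"
proof -
  have "8 * central_diff4 F a x = 24 * c4 * a ^ 4"
    by (simp add: central_diff4_def assms) algebra
  then show ?thesis by simp
qed

text \<open>The five sample points lie in [-1, 1] on one side of 0, so a single polynomial describes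
  the cosine sum at all of them. For exponent 2 its degree is below 4; for exponent 4 the leading
  coefficient \<open>- (pi ^ 4 / 3)\<close> produces exactly minus the constant in
  \<open>spline\<close>.\<close>

lemma spline_support:
  assumes "0 < a" "a \<le> 1/4" "\<bar>x\<bar> \<le> 1/2" "2 * a \<le> \<bar>x\<bar>"
  shows "spline a x = 0" "spline'' a x = 0"
proof -
  define \<sigma> :: real where "\<sigma> = sgn x"
  have y: "\<bar>y\<bar> \<le> 1" "\<bar>y\<bar> = \<sigma> * y" and y3: "\<bar>y\<bar> ^ 3 = \<sigma> * y ^ 3"
    if "y \<in> {x, x - a, x + a, x - 2 * a, x + 2 * a}" for y
  proof -
    have "\<bar>y\<bar> \<le> 1 \<and> (\<sigma> = 1 \<and> y \<ge> 0 \<or> \<sigma> = -1 \<and> y \<le> 0)"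
      using that assms by (auto simp: \<sigma>_def sgn_if)
    then show "\<bar>y\<bar> \<le> 1" "\<bar>y\<bar> = \<sigma> * y" "\<bar>y\<bar> ^ 3 = \<sigma> * y ^ 3"
      by (auto simp: power3_eq_cube)
  qed
  have "central_diff4 (cos_sum 2) a x = 3 * 0 * a ^ 4"
    by (rule central_diff4_quartic[where ?c0.0 = "cos_sum 2 0" and ?c1.0 = "- pi\<^sup>2 * \<sigma>" and ?c2.0 = "pi\<^sup>2" and ?c3.0 = 0],
        subst cos_sum_2, use y in blast, subst y(2), assumption) (simp add: algebra_simps)
  then show "spline'' a x = 0" by (simp add: spline''_def)
  have "central_diff4 (cos_sum 4) a x = 3 * (- (pi ^ 4 / 3)) * a ^ 4"
    by (rule central_diff4_quartic[where ?c0.0 = "cos_sum 4 0" and ?c1.0 = 0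
          and ?c2.0 = "- 2 * pi\<^sup>2 * cos_sum 2 0" and ?c3.0 = "2 * pi ^ 4 / 3 * \<sigma>"],
        subst cos_sum_4, use y in blast, subst y3, assumption) (simp add: algebra_simps)
  then show "spline a x = 0" by (simp add: spline_def power_mult_distrib)
qed

text \<open>The ratio of these two values decides how large \<open>b\<close> may be for the minorant
  to stay positive at 0.\<close>

lemma spline_at_0:
  assumes "0 < a" "a \<le> 1/4"
  shows "spline a 0 = 2/3 * pi ^ 4 * a ^ 3" "spline'' a 0 = pi\<^sup>2 * a / 2"
proof -
  have at_0: "central_diff4 (cos_sum s) a 0 = (3 * cos_sum s 0 - 4 * cos_sum s a + cos_sum s (2 * a)) / 4" for s
    by (simp add: central_diff4_def cos_sum_minus)
  have abs: "\<bar>a\<bar> = a" "\<bar>2 * a\<bar> = 2 * a" and le: "\<bar>a\<bar> \<le> 1" "\<bar>2 * a\<bar> \<le> 1"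
    using assms by auto
  show "spline'' a 0 = pi\<^sup>2 * a / 2"
    unfolding spline''_def at_0 cos_sum_2[OF le(1)] cos_sum_2[OF le(2)] abs
    by (simp add: power2_eq_square power3_eq_cube power4_eq_xxxx algebra_simps)
  show "spline a 0 = 2/3 * pi ^ 4 * a ^ 3"
    unfolding spline_def at_0 cos_sum_4[OF le(1)] cos_sum_4[OF le(2)] abs
    by (simp add: power2_eq_square power3_eq_cube power4_eq_xxxx algebra_simps add_divide_distrib diff_divide_distrib)
qed

section \<open>Linear independence of separated exponentials\<close>

text \<open>Reduces to the product rule for absolutely convergent sums. If some factor has absolute
  sum 0, it vanishes identically and both sides are 0.\<close>

lemma has_sum_prod_UNIV:
  fixes g :: "'d::finite \<Rightarrow> 'k \<Rightarrow> complex"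
  assumes "\<And>i. (g i has_sum s i) UNIV"
  shows "((\<lambda>k. \<Prod>i\<in>UNIV. g i (k i)) has_sum (\<Prod>i\<in>UNIV. s i)) UNIV"
proof -
  have summ: "(\<lambda>x. norm (g i x)) summable_on UNIV" for i
    using has_sum_imp_summable[OF assms[of i]] by (simp add: summable_on_iff_abs_summable_on_complex)
  define N where "N i = infsum (\<lambda>x. norm (g i x)) UNIV" for i
  show ?thesis
  proof (cases "\<exists>i. N i = 0")
    case True
    then obtain i where "N i = 0" by blast
    then have "g i x = 0" for x
      using nonneg_infsum_le_0D[of "\<lambda>x. norm (g i x)" UNIV x] summ[of i] by (simp add: N_def)
    then have "(\<lambda>k. \<Prod>i\<in>UNIV. g i (k i)) = (\<lambda>_. 0)"
      by (auto simp: fun_eq_iff)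
    moreover have "s i = 0"
      using has_sum_unique[OF assms[of i], of 0] \<open>\<And>x. g i x = 0\<close> by (simp cong: has_sum_cong)
    then have "(\<Prod>i\<in>UNIV. s i) = 0" by auto
    ultimately show ?thesis by (simp only: has_sum_0_simp)
  next
    case False
    have "infsum (\<lambda>k. \<Prod>i\<in>UNIV. norm (g i (k i))) (PiE UNIV (\<lambda>_. UNIV)) = (\<Prod>i\<in>UNIV. N i)"
      unfolding N_def by (rule infsum_prod_PiE_abs) (use summ in simp_all)
    also have "\<dots> \<noteq> 0" using False by simp
    \<comment> \<open>A family that is not summable has \<open>infsum\<close> equal to 0, so a
      nonzero value proves summability.\<close>
    finally have "(\<lambda>k. \<Prod>i\<in>UNIV. norm (g i (k i))) summable_on UNIV"
      using infsum_not_exists by (force simp: PiE_UNIV_domain)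
    then have "(\<lambda>k. norm (\<Prod>i\<in>UNIV. g i (k i))) summable_on UNIV"
      by (simp add: prod_norm)
    then have "(\<lambda>k. \<Prod>i\<in>UNIV. g i (k i)) summable_on UNIV"
      by (rule abs_summable_summable)
    moreover have "infsum (\<lambda>k. \<Prod>i\<in>UNIV. g i (k i)) (PiE UNIV (\<lambda>_. UNIV)) = (\<Prod>i\<in>UNIV. infsum (g i) UNIV)"
      by (rule infsum_prod_PiE_abs) (use summ in simp_all)
    moreover have "infsum (g i) UNIV = s i" for i
      using assms by (rule infsumI)
    ultimately show ?thesis
      by (simp add: has_sum_iff PiE_UNIV_domain)
  qed
qed

lemma has_sum_sum:
  fixes f :: "'a \<Rightarrow> 'b \<Rightarrow> 'c :: topological_comm_monoid_add"
  assumes "finite I" "\<And>i. i \<in> I \<Longrightarrow> (f i has_sum s i) A"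
  shows "((\<lambda>x. \<Sum>i\<in>I. f i x) has_sum (\<Sum>i\<in>I. s i)) A"
  using assms by (induction I rule: finite_induct) (auto intro: has_sum_add)

text \<open>The sum of \<open>w k * (norm (S k))\<^sup>2\<close> over \<open>k\<close> is evaluated
  twice: orthogonality in \<open>sums\<close> leaves \<open>v\<close> times the squared norm of
  \<open>c\<close>, while no term is positive because \<open>S k\<close> vanishes wherever
  \<open>w k\<close> may be positive.\<close>

lemma independent_of_minorant:
  fixes E :: "'j \<Rightarrow> 'k \<Rightarrow> complex" and w :: "'k \<Rightarrow> real"
  assumes fin: "finite J"
    and sums: "\<And>j l. j \<in> J \<Longrightarrow> l \<in> J \<Longrightarrow>
      ((\<lambda>k. of_real (w k) * (E j k * cnj (E l k))) has_sum (if j = l then of_real v else 0)) UNIV"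
    and "v > 0"
    and w: "\<And>k. w k \<le> 0 \<or> (\<Sum>j\<in>J. c j * E j k) = 0"
    and "j \<in> J"
  shows "c j = 0"
proof -
  define S where "S k = (\<Sum>j\<in>J. c j * E j k)" for k
  have "((\<lambda>k. \<Sum>j\<in>J. \<Sum>l\<in>J. (c j * cnj (c l)) * (of_real (w k) * (E j k * cnj (E l k)))) has_sum
      (\<Sum>j\<in>J. \<Sum>l\<in>J. (c j * cnj (c l)) * (if j = l then of_real v else 0))) UNIV"
    by (intro has_sum_sum fin has_sum_cmult_right sums)
  also have "(\<lambda>k. \<Sum>j\<in>J. \<Sum>l\<in>J. (c j * cnj (c l)) * (of_real (w k) * (E j k * cnj (E l k))))
      = (\<lambda>k. of_real (w k * (norm (S k))\<^sup>2))"
  proof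
    fix k
    have "of_real (w k * (norm (S k))\<^sup>2) = of_real (w k) * (S k * cnj (S k))"
      by (simp only: of_real_mult complex_norm_square)
    also have "\<dots> = (\<Sum>j\<in>J. \<Sum>l\<in>J. (c j * cnj (c l)) * (of_real (w k) * (E j k * cnj (E l k))))"
    proof -
      have "S k * cnj (S k) = (\<Sum>j\<in>J. \<Sum>l\<in>J. (c j * E j k) * cnj (c l * E l k))"
        unfolding S_def cnj_sum sum_product ..
      then show ?thesis
        by (simp only: sum_distrib_left) (intro sum.cong refl, simp)
    qed
    finally show "(\<Sum>j\<in>J. \<Sum>l\<in>J. (c j * cnj (c l)) * (of_real (w k) * (E j k * cnj (E l k))))
      = of_real (w k * (norm (S k))\<^sup>2)" by simp
  qed
  also have "(\<Sum>j\<in>J. \<Sum>l\<in>J. (c j * cnj (c l)) * (if j = l then of_real v else 0))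
      = of_real (v * (\<Sum>j\<in>J. (norm (c j))\<^sup>2))"
    using fin by (simp add: if_distrib sum_distrib_left mult_ac complex_norm_square[symmetric] cong: if_cong
        del: of_real_power)
  finally have "((\<lambda>k. w k * (norm (S k))\<^sup>2) has_sum v * (\<Sum>j\<in>J. (norm (c j))\<^sup>2)) UNIV"
    by (simp only: has_sum_of_real_iff)
  then have "((\<lambda>k. - (w k * (norm (S k))\<^sup>2)) has_sum - (v * (\<Sum>j\<in>J. (norm (c j))\<^sup>2))) UNIV"
    by (rule has_sum_uminusI)
  moreover have "- (w k * (norm (S k))\<^sup>2) \<ge> 0" for k
    using w[of k] by (auto simp: S_def mult_nonpos_nonneg)
  ultimately have "- (v * (\<Sum>j\<in>J. (norm (c j))\<^sup>2)) \<ge> 0"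
    by (rule has_sum_nonneg)
  then have "v * (\<Sum>j\<in>J. (norm (c j))\<^sup>2) \<le> 0" by simp
  then have "(\<Sum>j\<in>J. (norm (c j))\<^sup>2) \<le> 0"
    using \<open>v > 0\<close> by (simp add: mult_le_0_iff)
  then have "(\<Sum>j\<in>J. (norm (c j))\<^sup>2) = 0"
    by (intro antisym sum_nonneg) auto
  then show ?thesis
    using fin \<open>j \<in> J\<close> by (simp add: sum_nonneg_eq_0_iff)
qed

section \<open>The minorant and its Fourier series\<close>

text \<open>The Laplacian multiplies the exponential of frequency \<open>k\<close> by minus
  \<open>4 * pi\<^sup>2\<close> times the squared length of \<open>k\<close>, which turns the
  operator defining \<open>W\<close> into the second factor.\<close>

definition minorant_coeff :: "real \<Rightarrow> real \<Rightarrow> ('d::finite \<Rightarrow> int) \<Rightarrow> real" where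
  "minorant_coeff a b k = (\<Prod>i\<in>UNIV. spline_coeff a (k i)) * (1 - b * (\<Sum>i\<in>UNIV. (of_int (k i))\<^sup>2))"

text \<open>The Laplacian of a product of univariate splines: summand \<open>l\<close>
  differentiates the factor \<open>l\<close> twice. The minus sign comes from the normalisation of
  \<open>spline''\<close>.\<close>

definition minorant :: "real \<Rightarrow> real \<Rightarrow> ('d::finite \<Rightarrow> real) \<Rightarrow> real" where
  "minorant a b u = (\<Prod>i\<in>UNIV. spline a (u i)) -
     b * (\<Sum>l\<in>UNIV. \<Prod>i\<in>UNIV. if i = l then spline'' a (u i) else spline a (u i))"

lemma has_sum_minorant:
  fixes u :: "'d::finite \<Rightarrow> real"
  shows "((\<lambda>k. of_real (minorant_coeff a b k) * (\<Prod>i\<in>UNIV. cis (2 * pi * of_int (k i) * u i)))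
     has_sum of_real (minorant a b u)) UNIV"
proof -
  let ?e = "\<lambda>k::'d \<Rightarrow> int. \<Prod>i\<in>UNIV. cis (2 * pi * of_int (k i) * u i)"
  let ?p = "\<lambda>k::'d \<Rightarrow> int. \<Prod>i\<in>UNIV. spline_coeff a (k i)"
  have "((\<lambda>k. \<Prod>i\<in>UNIV. of_real (spline_coeff a (k i)) * cis (2 * pi * of_int (k i) * u i))
      has_sum (\<Prod>i\<in>UNIV. of_real (spline a (u i)))) UNIV"
    by (rule has_sum_prod_UNIV) (rule has_sum_spline)
  then have 1: "((\<lambda>k. of_real (?p k) * ?e k) has_sum of_real (\<Prod>i\<in>UNIV. spline a (u i))) UNIV"
    by (simp add: prod.distrib)
  \<comment> \<open>The weight in coordinate \<open>l\<close> is absorbed into the factor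
    \<open>l\<close>, so the product rule applies again.\<close>
  have 2: "((\<lambda>k. of_real ((of_int (k l))\<^sup>2) * (of_real (?p k) * ?e k)) has_sum
      of_real (\<Prod>i\<in>UNIV. if i = l then spline'' a (u i) else spline a (u i))) UNIV" for l
  proof -
    have "((\<lambda>k. \<Prod>i\<in>UNIV. (if i = l then of_real ((of_int (k i))\<^sup>2) else 1) *
           (of_real (spline_coeff a (k i)) * cis (2 * pi * of_int (k i) * u i)))
        has_sum (\<Prod>i\<in>UNIV. of_real (if i = l then spline'' a (u i) else spline a (u i)))) UNIV"
    proof (rule has_sum_prod_UNIV)
      show "((\<lambda>k. (if i = l then of_real ((of_int k)\<^sup>2) else 1) *
           (of_real (spline_coeff a k) * cis (2 * pi * of_int k * u i)))
        has_sum of_real (if i = l then spline'' a (u i) else spline a (u i))) UNIV" for i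
      proof (cases "i = l")
        case True
        then show ?thesis
          using has_sum_spline''[of a "u i"] by (simp only: of_real_mult mult.assoc if_True simp_thms)
      next
        case False
        then show ?thesis
          using has_sum_spline[of a "u i"] by (simp only: if_False mult_1_left)
      qed
    qed
    then show ?thesis
      by (simp only: prod.distrib of_real_prod prod.delta finite_UNIV if_True UNIV_I finite)
  qed
  have "((\<lambda>k. of_real (?p k) * ?e k + of_real (- b) *
       (\<Sum>l\<in>UNIV. of_real ((of_int (k l))\<^sup>2) * (of_real (?p k) * ?e k))) has_sum
      (of_real (\<Prod>i\<in>UNIV. spline a (u i)) + of_real (- b) *
        (\<Sum>l\<in>UNIV. of_real (\<Prod>i\<in>UNIV. if i = l then spline'' a (u i) else spline a (u i))))) UNIV"
    by (intro has_sum_add 1 has_sum_cmult_right has_sum_sum 2) simp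
  moreover have "of_real (?p k) * ?e k + of_real (- b) *
       (\<Sum>l\<in>UNIV. of_real ((of_int (k l))\<^sup>2) * (of_real (?p k) * ?e k))
     = of_real (minorant_coeff a b k) * ?e k" for k
    by (simp add: minorant_coeff_def sum_distrib_right[symmetric] algebra_simps)
  moreover have "of_real (\<Prod>i\<in>UNIV. spline a (u i)) + of_real (- b) *
        (\<Sum>l\<in>UNIV. of_real (\<Prod>i\<in>UNIV. if i = l then spline'' a (u i) else spline a (u i)))
     = (of_real (minorant a b u) :: complex)"
    by (simp only: minorant_def of_real_diff of_real_mult of_real_sum of_real_minus) simp
  ultimately show ?thesis by (simp only:)
qed

text \<open>Every product in the definition contains a factor from coordinate \<open>i\<close>, so
  one far coordinate suffices.\<close>

lemma minorant_eq_0: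
  assumes "spline a (u i) = 0" "spline'' a (u i) = 0"
  shows "minorant a b u = 0"
proof -
  have "(\<Prod>j\<in>UNIV. if j = l then spline'' a (u j) else spline a (u j)) = 0" for l
    using assms by (intro prod_zero[OF finite] bexI[of _ i]) auto
  moreover have "(\<Prod>j\<in>UNIV. spline a (u j)) = 0"
    using assms by (intro prod_zero[OF finite] bexI[of _ i]) auto
  ultimately show ?thesis by (simp only: minorant_def) simp
qed

lemma minorant_0:
  "minorant a b (\<lambda>_::'d::finite. 0) = spline a 0 ^ (CARD('d) - 1) * (spline a 0 - b * CARD('d) * spline'' a 0)"
proof -
  have "(\<Prod>i\<in>(UNIV::'d set). if i = l then spline'' a 0 else spline a 0) = spline'' a 0 * spline a 0 ^ (CARD('d) - 1)" for l
    by (subst prod.remove[of _ l]) (auto simp: card_Diff_singleton)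
  moreover have "spline a 0 ^ CARD('d) = spline a 0 * spline a 0 ^ (CARD('d) - 1)"
    using power_Suc[of "spline a 0" "CARD('d) - 1"] by simp
  ultimately show ?thesis
    by (simp add: minorant_def algebra_simps)
qed

lemma minorant_coeff_nonpos: "b * (\<Sum>i\<in>UNIV. (of_int (k i))\<^sup>2) \<ge> 1 \<Longrightarrow> minorant_coeff a b k \<le> 0"
  unfolding minorant_coeff_def by (intro mult_nonneg_nonpos prod_nonneg) (auto simp: spline_coeff_nonneg)

lemma torus_point_nth: "torus_point s $ i = cis (2 * pi * (s $ i))"
  by (simp add: torus_point_def cis_conv_exp mult_ac)

text \<open>Allows node differences to be reduced modulo 1 to [-1/2, 1/2], where
  \<open>spline_support\<close> applies.\<close>

lemma cis_shift_int: "cis (2 * pi * of_int k * (x - of_int r)) = cis (2 * pi * of_int k * x)"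
proof -
  have "cis (2 * pi * of_int k * (x - of_int r)) = cis (2 * pi * of_int k * x) * cis (2 * pi * of_int (- (k * r)))"
    by (simp add: cis_mult algebra_simps)
  then show ?thesis by (simp only: cis_multiple_2pi Ints_of_int mult_1_right)
qed

text \<open>The minorant is scaled to separation \<open>q\<close> and to half the side length
  \<open>m\<close>; the bound on \<open>m\<close> makes the two scales compatible.\<close>

lemma independent_CARD_ge_2:
  fixes t :: "nat \<Rightarrow> real ^ 'd"
  assumes card: "CARD('d) \<ge> 2" and q: "0 < q" "q \<le> 1/2" and fin: "finite J"
    and sep: "\<And>j l. j \<in> J \<Longrightarrow> l \<in> J \<Longrightarrow> j \<noteq> l \<Longrightarrow>
       \<exists>i. \<bar>t j $ i - t l $ i - of_int (round (t j $ i - t l $ i))\<bar> \<ge> q"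
    and m: "real m > real CARD('d) powr (3/2) / q"
    and zero: "\<And>k. k \<in> index_cube m \<Longrightarrow> (\<Sum>j\<in>J. c j * (\<Prod>i\<in>UNIV. (torus_point (t j) $ i) ^ (k $ i))) = 0"
    and "j \<in> J"
  shows "c j = 0"
proof -
  \<comment> \<open>The support radius \<open>2 * a\<close> then equals the separation
    \<open>q\<close>.\<close>
  define a where "a = q / 2"
  have a: "0 < a" "a \<le> 1/4" using q by (auto simp: a_def)
  define d where "d = real CARD('d)"
  have d: "d \<ge> 2" using card by (simp add: d_def)
  have m_pos: "real m > 0"
    by (rule le_less_trans[OF _ m]) (use q in simp)
  \<comment> \<open>With this \<open>b\<close> the coefficients are nonpositive as soon as one
    coordinate of the frequency has absolute value at least \<open>m / 2\<close>.\<close>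
  define b where "b = 4 / (real m)\<^sup>2"
  have "d powr (3/2) < real m * q"
    using m q by (simp add: d_def field_simps)
  then have "(d powr (3/2))\<^sup>2 < (real m * q)\<^sup>2"
    by (intro power_strict_mono) auto
  moreover have "(d powr (3/2))\<^sup>2 = d ^ 3"
    using d by (simp add: powr_powr[symmetric] flip: powr_numeral powr_realpow) (simp add: powr_powr)
  ultimately have "d ^ 3 < (real m * q)\<^sup>2" by simp
  \<comment> \<open>The point where dimension at least 2 enters.\<close>
  moreover have "4 * d \<le> d ^ 3"
    using mult_mono[OF d d] d by (simp add: power3_eq_cube)
  ultimately have "4 * d < (real m * q)\<^sup>2" by simp
  then have bd: "b * d < q\<^sup>2"
    using m_pos by (simp add: b_def field_simps power_mult_distrib)
  have psi: "spline a 0 > 0" using a by (simp add: spline_at_0)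
  define v where "v = minorant a b (\<lambda>_::'d. 0)"
  have "v > 0"
  proof -
    \<comment> \<open>Positivity at 0 comes down to 3 \<le> \<open>pi\<^sup>2\<close>, given
      \<open>b * d < q\<^sup>2\<close>.\<close>
    have "b * d * spline'' a 0 < q\<^sup>2 * (pi\<^sup>2 * a / 2)"
      using bd a by (simp add: spline_at_0)
    also have "\<dots> = 2 * pi\<^sup>2 * a ^ 3"
      by (simp add: a_def power2_eq_square power3_eq_cube)
    also have "\<dots> \<le> 2/3 * pi ^ 4 * a ^ 3"
    proof -
      have "3 * 3 \<le> pi * pi" using pi_gt3 by (intro mult_mono) auto
      then have "3 * (pi\<^sup>2 * a ^ 3) \<le> pi\<^sup>2 * (pi\<^sup>2 * a ^ 3)"
        using a by (intro mult_right_mono) (auto simp: power2_eq_square)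
      then show ?thesis by (simp add: power2_eq_square power4_eq_xxxx)
    qed
    finally have "spline a 0 - b * d * spline'' a 0 > 0"
      using a by (simp add: spline_at_0)
    then show ?thesis
      unfolding v_def minorant_0 using psi by (simp add: d_def)
  qed
  \<comment> \<open>For either parity of \<open>m\<close>, \<open>2 * h\<close> is at most
    \<open>m\<close>, and an integer exceeding \<open>h\<close> is at least
    \<open>m / 2\<close>.\<close>
  define h where "h = m div 2"
  define E where "E j k = (\<Prod>i\<in>UNIV. cis (2 * pi * of_int (k i) * (t j $ i)))" for j and k :: "'d \<Rightarrow> int"
  define c' where "c' j = c j * (\<Prod>i\<in>UNIV. cis (2 * pi * real h * (t j $ i)))" for j
  \<comment> \<open>The factor in \<open>c'\<close> translates the cube \<open>{0..m}\<^sup>d\<close> so that it contains \<open>{-h..h}\<^sup>d\<close>.\<close>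
  have "c' j = 0"
  proof (rule independent_of_minorant[OF fin _ \<open>v > 0\<close> _ \<open>j \<in> J\<close>])
    fix j l assume jl: "j \<in> J" "l \<in> J"
    define u where "u i = t j $ i - t l $ i - of_int (round (t j $ i - t l $ i))" for i
    have "E j k * cnj (E l k) = (\<Prod>i\<in>UNIV. cis (2 * pi * of_int (k i) * u i))" for k
    proof -
      have "E j k * cnj (E l k) = (\<Prod>i\<in>UNIV. cis (2 * pi * of_int (k i) * (t j $ i - t l $ i)))"
        by (simp add: E_def cis_cnj cis_mult algebra_simps flip: prod.distrib)
      then show ?thesis by (simp only: u_def cis_shift_int)
    qed
    moreover have "minorant a b u = (if j = l then v else 0)"
    proof (cases "j = l")
      case True
      then have "u = (\<lambda>_. 0)" by (simp add: u_def fun_eq_iff)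
      with True show ?thesis by (simp add: v_def)
    next
      case False
      from sep[OF jl False] obtain i where i: "\<bar>u i\<bar> \<ge> q" by (auto simp: u_def)
      have "\<bar>u i\<bar> \<le> 1/2"
        using of_int_round_abs_le[of "t j $ i - t l $ i"] by (simp add: u_def abs_minus_commute)
      with i a have "spline a (u i) = 0" "spline'' a (u i) = 0"
        by (auto intro!: spline_support simp: a_def)
      with False show ?thesis by (simp add: minorant_eq_0)
    qed
    ultimately show "((\<lambda>k. of_real (minorant_coeff a b k) * (E j k * cnj (E l k)))
        has_sum (if j = l then of_real v else 0)) UNIV"
      using has_sum_minorant[of a b u] by (simp split: if_splits)
  next
    fix k :: "'d \<Rightarrow> int"
    show "minorant_coeff a b k \<le> 0 \<or> (\<Sum>j\<in>J. c' j * E j k) = 0"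
    proof (cases "\<forall>i. \<bar>k i\<bar> \<le> int h")
      case True
      define k' :: "nat ^ 'd" where "k' = (\<chi> i. nat (k i + int h))"
      have k': "real (k' $ i) = of_int (k i) + real h" for i
        using True[rule_format, of i] by (simp add: k'_def)
      have "k i + int h \<le> int m" for i
      proof -
        have "2 * h \<le> m" by (simp add: h_def)
        with True[rule_format, of i] show ?thesis by linarith
      qed
      then have "k' \<in> index_cube m"
        by (simp add: k'_def index_cube_def nat_le_iff)
      moreover have "c' j * E j k = c j * (\<Prod>i\<in>UNIV. (torus_point (t j) $ i) ^ (k' $ i))" for j
      proof -
        have "cis (2 * pi * real h * (t j $ i)) * cis (2 * pi * of_int (k i) * (t j $ i))
            = (torus_point (t j) $ i) ^ (k' $ i)" for i
          by (simp add: torus_point_nth Complex.DeMoivre cis_mult k' algebra_simps)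
        then show ?thesis
          by (simp add: c'_def E_def mult.assoc flip: prod.distrib)
      qed
      ultimately show ?thesis using zero[of k'] by simp
    next
      case False
      then obtain i where "\<bar>k i\<bar> > int h" by (auto simp: not_le)
      then have "real m \<le> 2 * \<bar>real_of_int (k i)\<bar>"
        unfolding h_def by linarith
      then have "(real m)\<^sup>2 \<le> (2 * \<bar>real_of_int (k i)\<bar>)\<^sup>2"
        by (intro power_mono) auto
      then have "1 \<le> b * (real_of_int (k i))\<^sup>2"
        using m_pos by (simp add: b_def power_mult_distrib)
      also have "\<dots> \<le> b * (\<Sum>i\<in>UNIV. (real_of_int (k i))\<^sup>2)"
        by (intro mult_left_mono member_le_sum) (auto simp: b_def)
      finally show ?thesis by (intro disjI1 minorant_coeff_nonpos)
    qed
  qed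
  then show ?thesis by (simp add: c'_def)
qed

section \<open>The one-dimensional case\<close>

text \<open>The relation is tested against the polynomial vanishing at all nodes except
  \<open>z j\<close>, whose degree \<open>card J - 1\<close> is at most \<open>m\<close>.\<close>

lemma vandermonde_independent:
  fixes z :: "'j \<Rightarrow> 'a :: idom"
  assumes fin: "finite J" and inj: "inj_on z J" and card: "card J \<le> m + 1"
    and zero: "\<And>k. k \<le> m \<Longrightarrow> (\<Sum>j\<in>J. c j * z j ^ k) = 0"
    and "j \<in> J"
  shows "c j = 0"
proof -
  define p where "p = (\<Prod>l\<in>J - {j}. [:- z l, 1:])"
  have "degree p \<le> (\<Sum>l\<in>J - {j}. 1)"
    unfolding p_def by (rule order.trans[OF degree_prod_sum_le]) (use fin in auto)
  then have "degree p \<le> m"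
    using card fin \<open>j \<in> J\<close> by simp
  have poly_p: "poly p (z l) = 0" if "l \<in> J" "l \<noteq> j" for l
    using that fin by (auto simp: p_def poly_prod)
  have "(\<Sum>l\<in>J. c l * poly p (z l)) = (\<Sum>k\<le>degree p. coeff p k * (\<Sum>l\<in>J. c l * z l ^ k))"
    by (simp add: poly_altdef sum_distrib_left mult_ac) (rule sum.swap)
  also have "\<dots> = 0"
    using \<open>degree p \<le> m\<close> by (intro sum.neutral) (auto simp: zero)
  also have "(\<Sum>l\<in>J. c l * poly p (z l)) = c j * poly p (z j)"
    using fin \<open>j \<in> J\<close> poly_p by (subst sum.remove[of _ j]) (auto intro!: sum.neutral)
  finally have "c j * poly p (z j) = 0" .
  moreover have "poly p (z j) \<noteq> 0"
    using fin inj \<open>j \<in> J\<close> by (auto simp: p_def poly_prod inj_on_def)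
  ultimately show ?thesis by simp
qed

text \<open>Pigeonhole: distinct points fall into distinct cells of length \<open>q\<close>, and the
  cell indices run from 0 to the floor of \<open>1 / q\<close>.\<close>

lemma separated_card_le:
  fixes s :: "'j \<Rightarrow> real"
  assumes "\<And>j. j \<in> J \<Longrightarrow> s j \<in> {0..<1}" and "q > 0"
    and "\<And>j l. j \<in> J \<Longrightarrow> l \<in> J \<Longrightarrow> j \<noteq> l \<Longrightarrow> \<bar>s j - s l\<bar> \<ge> q"
  shows "real (card J) \<le> 1 / q + 1"
proof -
  define b where "b j = \<lfloor>s j / q\<rfloor>" for j
  have "inj_on b J"
  proof (rule inj_onI, rule ccontr)
    fix j l assume jl: "j \<in> J" "l \<in> J" "b j = b l" "j \<noteq> l"
    have "\<bar>s j / q - s l / q\<bar> < 1"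
      using jl(3) unfolding b_def by linarith
    then have "\<bar>s j - s l\<bar> < q"
      using \<open>q > 0\<close> by (simp add: diff_divide_distrib[symmetric])
    with assms(3)[of j l] jl show False by simp
  qed
  moreover have "b ` J \<subseteq> {0..\<lfloor>1 / q\<rfloor>}"
    using assms(1,2) by (fastforce simp: b_def intro!: floor_mono divide_right_mono)
  ultimately have "card J \<le> card {0..\<lfloor>1 / q\<rfloor>}"
    by (rule card_inj_on_le) simp
  moreover have "\<lfloor>1 / q\<rfloor> \<ge> 0"
    using \<open>q > 0\<close> by simp
  ultimately show ?thesis by (simp; linarith)
qed

text \<open>For d = 1 the estimate \<open>4 * d \<le> d ^ 3\<close> fails, so counting replaces the
  minorant: there are at most \<open>m + 1\<close> nodes, matching the exponents 0 to
  \<open>m\<close>.\<close>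

lemma independent_CARD_1:
  fixes t :: "nat \<Rightarrow> real ^ 'd"
  assumes card: "CARD('d) = 1" and "q > 0" and fin: "finite J"
    and unit: "\<And>j i. j \<in> J \<Longrightarrow> t j $ i \<in> {0..<1}"
    and sep: "\<And>j l. j \<in> J \<Longrightarrow> l \<in> J \<Longrightarrow> j \<noteq> l \<Longrightarrow>
       \<exists>i. \<bar>t j $ i - t l $ i - of_int (round (t j $ i - t l $ i))\<bar> \<ge> q"
    and m: "real m > 1 / q"
    and zero: "\<And>k. k \<in> index_cube m \<Longrightarrow> (\<Sum>j\<in>J. c j * (\<Prod>i\<in>UNIV. (torus_point (t j) $ i) ^ (k $ i))) = 0"
    and "j \<in> J"
  shows "c j = 0"
proof -
  from card obtain i :: 'd where i: "UNIV = {i}"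
    by (auto simp: card_1_singleton_iff)
  \<comment> \<open>Rounding picks the nearest integer, so the bound passes to every integer
    \<open>r\<close>: \<open>r = 0\<close> serves the counting, and general \<open>r\<close> the
    injectivity.\<close>
  have sep': "\<bar>t j $ i - t l $ i - of_int r\<bar> \<ge> q" if "j \<in> J" "l \<in> J" "j \<noteq> l" for j l r
  proof -
    from sep[OF that] obtain i' where i': "\<bar>t j $ i' - t l $ i' - of_int (round (t j $ i' - t l $ i'))\<bar> \<ge> q" ..
    have "i' = i" using i by auto
    with i' round_diff_minimal[of "t j $ i - t l $ i" r] show ?thesis by simp
  qed
  have "real (card J) \<le> 1 / q + 1"
    by (rule separated_card_le[where s = "\<lambda>j. t j $ i"]) (use unit sep'[where r = 0] \<open>q > 0\<close> in auto)
  with m have "card J \<le> m + 1" by linarith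
  moreover have "inj_on (\<lambda>j. torus_point (t j) $ i) J"
  proof (rule inj_onI, rule ccontr)
    fix j l assume jl: "j \<in> J" "l \<in> J" "torus_point (t j) $ i = torus_point (t l) $ i" "j \<noteq> l"
    then have "cis (2 * pi * (t j $ i) - 2 * pi * (t l $ i)) = 1"
      by (simp add: torus_point_nth flip: cis_divide)
    then obtain r :: int where "2 * pi * (t j $ i) - 2 * pi * (t l $ i) = 2 * pi * of_int r"
      by (auto simp: complex_eq_iff cos_one_2pi_int mult_ac)
    then have "2 * pi * (t j $ i - t l $ i) = 2 * pi * of_int r"
      by (simp only: right_diff_distrib)
    then have "t j $ i - t l $ i = of_int r" by simp
    with sep'[of j l r] jl \<open>q > 0\<close> show False by simp
  qed
  moreover have "(\<Sum>j\<in>J. c j * (torus_point (t j) $ i) ^ k) = 0" if "k \<le> m" for k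
    using zero[of "\<chi> i. k"] that by (simp add: index_cube_def i)
  ultimately show ?thesis
    using vandermonde_independent[OF fin] \<open>j \<in> J\<close> by blast
qed

section \<open>The kernel of the moment matrix\<close>

text \<open>Finite-dimensional duality: a vector outside a span is detected by a functional
  annihilating the span. The induction eliminates one spanning vector at a time.\<close>

lemma in_span_or_separated:
  fixes v :: "'j \<Rightarrow> 'k \<Rightarrow> 'a :: field"
  assumes "finite J" "finite K"
  shows "(\<exists>c. \<forall>k\<in>K. w k = (\<Sum>j\<in>J. c j * v j k)) \<or>
    (\<exists>p. (\<forall>j\<in>J. (\<Sum>k\<in>K. p k * v j k) = 0) \<and> (\<Sum>k\<in>K. p k * w k) \<noteq> 0)"
  using assms(1)
proof (induction J arbitrary: w rule: finite_induct)
  case empty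
  show ?case
  proof (cases "\<forall>k\<in>K. w k = 0")
    case False
    then obtain k where "k \<in> K" "w k \<noteq> 0" by blast
    moreover have "(\<Sum>l\<in>K. (if l = k then 1 else 0) * w l) = w k"
      using \<open>finite K\<close> \<open>k \<in> K\<close> by (simp add: if_distrib[of "\<lambda>x. x * _"] cong: if_cong)
    ultimately show ?thesis by (intro disjI2 exI[of _ "\<lambda>l. if l = k then 1 else 0"]) auto
  qed simp
next
  case (insert j J)
  from insert.IH[of "v j"] show ?case
  proof
    assume "\<exists>b. \<forall>k\<in>K. v j k = (\<Sum>l\<in>J. b l * v l k)"
    then obtain b where b: "\<And>k. k \<in> K \<Longrightarrow> v j k = (\<Sum>l\<in>J. b l * v l k)" by blast
    from insert.IH[of w] show ?thesis
    proof
      assume "\<exists>c. \<forall>k\<in>K. w k = (\<Sum>l\<in>J. c l * v l k)"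
      then obtain c where c: "\<And>k. k \<in> K \<Longrightarrow> w k = (\<Sum>l\<in>J. c l * v l k)" by blast
      have "(\<Sum>l\<in>insert j J. (c(j := 0)) l * v l k) = (\<Sum>l\<in>J. c l * v l k)" for k
        using insert.hyps by (auto intro!: sum.cong)
      with c show ?thesis by (intro disjI1 exI[of _ "c(j := 0)"]) auto
    next
      assume "\<exists>p. (\<forall>l\<in>J. (\<Sum>k\<in>K. p k * v l k) = 0) \<and> (\<Sum>k\<in>K. p k * w k) \<noteq> 0"
      then obtain p where p: "\<And>l. l \<in> J \<Longrightarrow> (\<Sum>k\<in>K. p k * v l k) = 0" "(\<Sum>k\<in>K. p k * w k) \<noteq> 0"
        by blast
      have "(\<Sum>k\<in>K. p k * v j k) = (\<Sum>k\<in>K. \<Sum>l\<in>J. b l * (p k * v l k))"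
        by (intro sum.cong refl) (simp add: b sum_distrib_left mult_ac)
      also have "\<dots> = (\<Sum>l\<in>J. b l * (\<Sum>k\<in>K. p k * v l k))"
        by (subst sum.swap) (simp add: sum_distrib_left)
      also have "\<dots> = 0" by (simp add: p(1))
      finally show ?thesis using p by (intro disjI2 exI[of _ p]) auto
    qed
  next
    assume "\<exists>p. (\<forall>l\<in>J. (\<Sum>k\<in>K. p k * v l k) = 0) \<and> (\<Sum>k\<in>K. p k * v j k) \<noteq> 0"
    then obtain p where p: "\<And>l. l \<in> J \<Longrightarrow> (\<Sum>k\<in>K. p k * v l k) = 0" "(\<Sum>k\<in>K. p k * v j k) \<noteq> 0"
      by blast
    define N where "N = (\<Sum>k\<in>K. p k * v j k)"
    \<comment> \<open>Chosen so that \<open>p\<close> annihilates \<open>w - a * v j\<close>; the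
      remainder is then tested against the smaller family.\<close>
    define a where "a = (\<Sum>k\<in>K. p k * w k) / N"
    from insert.IH[of "\<lambda>k. w k - a * v j k"] show ?thesis
    proof
      assume "\<exists>c. \<forall>k\<in>K. w k - a * v j k = (\<Sum>l\<in>J. c l * v l k)"
      then obtain c where c: "\<And>k. k \<in> K \<Longrightarrow> w k - a * v j k = (\<Sum>l\<in>J. c l * v l k)" by blast
      have "(\<Sum>l\<in>insert j J. (c(j := a)) l * v l k) = a * v j k + (\<Sum>l\<in>J. c l * v l k)" for k
        using insert.hyps by (auto intro!: sum.cong)
      with c show ?thesis
        by (intro disjI1 exI[of _ "c(j := a)"]) (auto simp flip: c)
    next
      assume "\<exists>r. (\<forall>l\<in>J. (\<Sum>k\<in>K. r k * v l k) = 0) \<and> (\<Sum>k\<in>K. r k * (w k - a * v j k)) \<noteq> 0"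
      then obtain r where r: "\<And>l. l \<in> J \<Longrightarrow> (\<Sum>k\<in>K. r k * v l k) = 0"
          "(\<Sum>k\<in>K. r k * (w k - a * v j k)) \<noteq> 0" by blast
      \<comment> \<open>Subtracting \<open>s * p\<close> from \<open>r\<close> makes it annihilate
        \<open>v j\<close> too, and its pairing with \<open>w\<close> equals that of
        \<open>r\<close> with \<open>w - a * v j\<close>.\<close>
      define s where "s = (\<Sum>k\<in>K. r k * v j k) / N"
      have comb: "(\<Sum>k\<in>K. (r k - s * p k) * y k) = (\<Sum>k\<in>K. r k * y k) - s * (\<Sum>k\<in>K. p k * y k)" for y
        by (simp add: algebra_simps sum_subtractf sum_distrib_left)
      have "(\<Sum>k\<in>K. r k * (w k - a * v j k)) = (\<Sum>k\<in>K. r k * w k) - a * (\<Sum>k\<in>K. r k * v j k)"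
        by (simp add: algebra_simps sum_subtractf sum_distrib_left)
      also have "\<dots> = (\<Sum>k\<in>K. r k * w k) - s * (\<Sum>k\<in>K. p k * w k)"
        by (simp add: a_def s_def)
      finally have "(\<Sum>k\<in>K. (r k - s * p k) * w k) \<noteq> 0"
        using r(2) by (simp add: comb)
      moreover have "(\<Sum>k\<in>K. (r k - s * p k) * v l k) = 0" if "l \<in> insert j J" for l
        unfolding comb using that p r by (auto simp: s_def N_def)
      ultimately show ?thesis
        by (intro disjI2 exI[of _ "\<lambda>k. r k - s * p k"]) auto
    qed
  qed
qed

section \<open>Polynomials on the cube, separation and moments\<close>

lemma finite_index_cube: "finite (index_cube n :: (nat ^ 'd) set)"
proof -
  have "(index_cube n :: (nat ^ 'd) set) \<subseteq> vec_lambda ` (UNIV \<rightarrow>\<^sub>E {..n})"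
  proof
    fix k :: "nat ^ 'd" assume "k \<in> index_cube n"
    then have "vec_nth k \<in> UNIV \<rightarrow>\<^sub>E {..n}" by (auto simp: index_cube_def)
    moreover have "k = vec_lambda (vec_nth k)" by simp
    ultimately show "k \<in> vec_lambda ` (UNIV \<rightarrow>\<^sub>E {..n})" by blast
  qed
  then show ?thesis
    by (rule finite_subset) (intro finite_imageI finite_PiE; simp)
qed

lemma eval_poly_of_vec:
  "eval_cpoly (poly_of_vec n p) x = (\<Sum>k\<in>index_cube n. p k * (\<Prod>i\<in>UNIV. (x $ i) ^ (k $ i)))"
proof -
  have lookup: "Poly_Mapping.lookup (poly_of_vec n p) k = (if k \<in> index_cube n then p k else 0)" for k
    by (simp add: poly_of_vec_def lookup_sum lookup_single when_def finite_index_cube)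
  have "eval_cpoly (poly_of_vec n p) x =
      (\<Sum>k\<in>index_cube n. Poly_Mapping.lookup (poly_of_vec n p) k * (\<Prod>i\<in>UNIV. (x $ i) ^ (k $ i)))"
    unfolding eval_cpoly_def
    by (rule sum.mono_neutral_left[OF finite_index_cube]) (auto simp: in_keys_iff lookup split: if_splits)
  then show ?thesis by (simp add: lookup)
qed

lemma infnorm_le: "(\<And>i. \<bar>x $ i\<bar> \<le> B) \<Longrightarrow> infnorm (x :: real ^ 'd) \<le> B"
  unfolding infnorm_cart by (rule cSup_least) auto

text \<open>The set in \<open>sep\<close> is bounded below by 0, so each of its members bounds the
  infimum from above. The shift is negated because \<open>sep\<close> adds the integer
  vector.\<close>

lemma sep_gt_imp:
  assumes "sep M t > q" "j \<in> {1..M}" "l \<in> {1..M}" "j \<noteq> l"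
  shows "\<exists>i. \<bar>t j $ i - t l $ i - of_int (r $ i)\<bar> > q"
proof (rule ccontr)
  assume *: "\<not> ?thesis"
  let ?s = "\<chi> i. - (r $ i)"
  have "sep M t \<le> infnorm (t j - t l + (\<chi> i. of_int (?s $ i)))"
    unfolding sep_def
  proof (rule cInf_lower)
    show "infnorm (t j - t l + (\<chi> i. of_int (?s $ i))) \<in>
        {infnorm (t j - t l + (\<chi> i. of_int (r $ i))) | j l r. j \<in> {1..M} \<and> l \<in> {1..M} \<and> j \<noteq> l}"
      using assms(2-4) by blast
  qed (auto intro!: bdd_belowI[of _ 0] simp: infnorm_pos_le)
  also have "\<dots> \<le> q"
    using * by (intro infnorm_le) (auto simp: not_less)
  finally show False using assms(1) by simp
qed

text \<open>On the torus inversion is conjugation; this factorises the moment matrix.\<close>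

lemma mono_int_diff_torus_point:
  "mono_int (torus_point s) (\<chi> i. int (k $ i) - int (l $ i)) =
     (\<Prod>i\<in>UNIV. (torus_point s $ i) ^ (k $ i)) * cnj (\<Prod>i\<in>UNIV. (torus_point s $ i) ^ (l $ i))"
proof -
  have "cis a powi (int b - int c) = cis a ^ b * cnj (cis a ^ c)" for a b c
    by (simp add: power_int_diff divide_inverse flip: power_inverse cis_cnj)
  then show ?thesis
    by (simp add: mono_int_def torus_point_nth prod.distrib)
qed

theorem theorem3p11:
  fixes t :: "nat \<Rightarrow> real ^ 'd"
    and fhat :: "nat \<Rightarrow> complex"
    and x :: "nat \<Rightarrow> complex ^ 'd"
    and \<Omega> :: "(complex ^ 'd) set"
    and f :: "int ^ 'd \<Rightarrow> complex"
    and M n :: nat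
    and q :: real
  assumes "M \<ge> 1"
    and "\<And>j i. j \<in> {1..M} \<Longrightarrow> t j $ i \<in> {0..<1}"
    and "inj_on t {1..M}"
    and "\<And>j. j \<in> {1..M} \<Longrightarrow> fhat j \<noteq> 0"
    and "\<And>j. j \<in> {1..M} \<Longrightarrow> x j = torus_point (t j)"
    and "\<Omega> = x ` {1..M}"
    and "f = expsum M fhat x"
    and "q > 0"
    and "M = 1 \<or> sep M t > q"
    and "real n > real CARD('d) powr (3 / 2) / q + real CARD('d) + 1"
  shows "\<Omega> = zero_locus (poly_of_vec n ` cube_kernel n (moment_matrix f))"
proof -
  define X where "X y k = (\<Prod>i\<in>UNIV. (y $ i) ^ (k $ i))" for y :: "complex ^ 'd" and k :: "nat ^ 'd"
  \<comment> \<open>Independence is proved on the cube of side \<open>m\<close>, one less than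
    \<open>n\<close>, to leave room for raising one exponent later.\<close>
  define m where "m = n - 1"
  have "real CARD('d) powr (3 / 2) / q \<ge> 0" using \<open>q > 0\<close> by simp
  then have n: "n = Suc m" and m: "real m > real CARD('d) powr (3 / 2) / q"
    using assms(10) by (auto simp: m_def)
  have independent: "c j = 0"
    if zero: "\<And>k. k \<in> index_cube m \<Longrightarrow> (\<Sum>j=1..M. c j * X (x j) k) = 0" and j: "j \<in> {1..M}" for c j
  proof (cases "M = 1")
    \<comment> \<open>With one node the exponent 0 already gives the claim; \<open>sep\<close>
      carries no information here.\<close>
    case True
    then show ?thesis
      using zero[of 0] j by (simp add: index_cube_def X_def)
  next
    case False
    then have sep: "\<And>r j l. j \<in> {1..M} \<Longrightarrow> l \<in> {1..M} \<Longrightarrow> j \<noteq> l \<Longrightarrow>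
        \<exists>i. \<bar>t j $ i - t l $ i - of_int (r $ i)\<bar> > q"
      using assms(9) sep_gt_imp by blast
    have sep': "\<exists>i. \<bar>t j $ i - t l $ i - of_int (round (t j $ i - t l $ i))\<bar> \<ge> q"
      if "j \<in> {1..M}" "l \<in> {1..M}" "j \<noteq> l" for j l
      using sep[OF that, of "\<chi> i. round (t j $ i - t l $ i)"] by (auto intro: less_imp_le)
    have zero': "(\<Sum>j=1..M. c j * (\<Prod>i\<in>UNIV. (torus_point (t j) $ i) ^ (k $ i))) = 0" if "k \<in> index_cube m" for k
      using zero[OF that] by (simp add: X_def assms(5))
    show ?thesis
    proof (cases "CARD('d) = 1")
      case True
      with m have "real m > 1 / q" by simp
      then show ?thesis
        using independent_CARD_1[OF True \<open>q > 0\<close> _ assms(2) sep' _ zero'] j by blast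
    next
      case False
      have "CARD('d) \<noteq> 0" by simp
      with False have "CARD('d) \<ge> 2" by linarith
      moreover have "q \<le> 1/2"
      proof -
        have "1 \<in> {1..M}" "2 \<in> {1..M}" "(1::nat) \<noteq> 2" using \<open>M \<noteq> 1\<close> assms(1) by auto
        from sep'[OF this] obtain i where "q \<le> \<bar>t 1 $ i - t 2 $ i - of_int (round (t 1 $ i - t 2 $ i))\<bar>" ..
        also have "\<dots> \<le> 1/2"
          using of_int_round_abs_le[of "t 1 $ i - t 2 $ i"] by (simp add: abs_minus_commute)
        finally show ?thesis .
      qed
      ultimately show ?thesis
        using independent_CARD_ge_2[OF _ \<open>q > 0\<close> _ _ sep' m zero'] j by blast
    qed
  qed
  have kernel: "p \<in> cube_kernel n (moment_matrix f) \<longleftrightarrow>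
      (\<forall>k. k \<notin> index_cube n \<longrightarrow> p k = 0) \<and> (\<forall>j\<in>{1..M}. (\<Sum>k\<in>index_cube n. p k * X (x j) k) = 0)" for p
  proof -
    define P where "P j = (\<Sum>k\<in>index_cube n. p k * X (x j) k)" for j
    have row: "(\<Sum>k\<in>index_cube n. moment_matrix f l k * p k) = (\<Sum>j=1..M. fhat j * P j * cnj (X (x j) l))" for l
    proof -
      have "moment_matrix f l k = (\<Sum>j=1..M. fhat j * (X (x j) k * cnj (X (x j) l)))" for k
        unfolding moment_matrix_def assms(7) expsum_def
        by (intro sum.cong refl) (simp add: assms(5) mono_int_diff_torus_point X_def)
      then have "(\<Sum>k\<in>index_cube n. moment_matrix f l k * p k) =
          (\<Sum>k\<in>index_cube n. \<Sum>j=1..M. fhat j * (p k * X (x j) k) * cnj (X (x j) l))"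
        by (intro sum.cong refl) (simp add: sum_distrib_left mult_ac)
      also have "\<dots> = (\<Sum>j=1..M. fhat j * P j * cnj (X (x j) l))"
        unfolding P_def by (subst sum.swap) (simp add: sum_distrib_left sum_distrib_right)
      finally show ?thesis .
    qed
    have "P j = 0" if rows: "\<forall>l\<in>index_cube n. (\<Sum>k\<in>index_cube n. moment_matrix f l k * p k) = 0"
      and j: "j \<in> {1..M}" for j
    proof -
      \<comment> \<open>The rows involve conjugated monomials, so the relation is conjugated before
        independence is applied.\<close>
      have "cnj (fhat j * P j) = 0"
      proof (rule independent[OF _ j])
        fix l :: "nat ^ 'd" assume "l \<in> index_cube m"
        then have "l \<in> index_cube n" by (auto simp: index_cube_def n le_SucI)
        with rows have "cnj (\<Sum>j=1..M. fhat j * P j * cnj (X (x j) l)) = 0" by (simp add: row)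
        then show "(\<Sum>j=1..M. cnj (fhat j * P j) * X (x j) l) = 0" by simp
      qed
      with assms(4)[OF j] show ?thesis by simp
    qed
    then show ?thesis
      unfolding cube_kernel_def mem_Collect_eq P_def[symmetric] by (auto simp: row)
  qed
  have locus: "zero_locus (poly_of_vec n ` cube_kernel n (moment_matrix f)) =
      {y. \<forall>p\<in>cube_kernel n (moment_matrix f). (\<Sum>k\<in>index_cube n. p k * X y k) = 0}"
    by (auto simp: zero_locus_def eval_poly_of_vec X_def)
  show ?thesis
    unfolding locus
  proof (intro equalityI subsetI)
    fix y assume "y \<in> \<Omega>"
    then show "y \<in> {y. \<forall>p\<in>cube_kernel n (moment_matrix f). (\<Sum>k\<in>index_cube n. p k * X y k) = 0}"
      using assms(6) kernel by auto
  next
    fix y assume y: "y \<in> {y. \<forall>p\<in>cube_kernel n (moment_matrix f). (\<Sum>k\<in>index_cube n. p k * X y k) = 0}"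
    have "\<not> (\<exists>p. (\<forall>j\<in>{1..M}. (\<Sum>k\<in>index_cube n. p k * X (x j) k) = 0) \<and> (\<Sum>k\<in>index_cube n. p k * X y k) \<noteq> 0)"
    proof
      assume "\<exists>p. (\<forall>j\<in>{1..M}. (\<Sum>k\<in>index_cube n. p k * X (x j) k) = 0) \<and> (\<Sum>k\<in>index_cube n. p k * X y k) \<noteq> 0"
      then obtain p where p: "\<forall>j\<in>{1..M}. (\<Sum>k\<in>index_cube n. p k * X (x j) k) = 0" "(\<Sum>k\<in>index_cube n. p k * X y k) \<noteq> 0"
        by blast
      \<comment> \<open>Kernel vectors must vanish outside the cube, hence the truncation.\<close>
      define p' where "p' k = (if k \<in> index_cube n then p k else 0)" for k
      have "(\<Sum>k\<in>index_cube n. p' k * X z k) = (\<Sum>k\<in>index_cube n. p k * X z k)" for z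
        by (intro sum.cong) (auto simp: p'_def)
      with p y kernel[of p'] show False by (auto simp: p'_def)
    qed
    then obtain c where c: "\<And>k. k \<in> index_cube n \<Longrightarrow> X y k = (\<Sum>j=1..M. c j * X (x j) k)"
      using in_span_or_separated[OF finite_atLeastAtMost finite_index_cube,
          where w = "X y" and v = "\<lambda>j. X (x j)"] by blast
    have "c j * (x j $ i - y $ i) = 0" if j: "j \<in> {1..M}" for i j
    proof (rule independent[OF _ j])
      fix k :: "nat ^ 'd" assume k: "k \<in> index_cube m"
      \<comment> \<open>Raising the exponent in coordinate \<open>i\<close> multiplies a monomial by
        that coordinate, and \<open>k'\<close> still lies in the cube of side
        \<open>n\<close>.\<close>
      define k' where "k' = (\<chi> l. if l = i then Suc (k $ l) else k $ l)"
      have cube: "k \<in> index_cube n" "k' \<in> index_cube n"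
        using k by (auto simp: index_cube_def n k'_def le_SucI)
      have X_k': "X z k' = z $ i * X z k" for z
      proof -
        have "X z k' = (\<Prod>l\<in>UNIV. (if l = i then z $ l else 1) * (z $ l) ^ (k $ l))"
          unfolding X_def k'_def by (intro prod.cong) auto
        then show ?thesis by (simp add: prod.distrib X_def)
      qed
      have "(\<Sum>j=1..M. c j * (x j $ i - y $ i) * X (x j) k) =
          (\<Sum>j=1..M. c j * X (x j) k') - y $ i * (\<Sum>j=1..M. c j * X (x j) k)"
        by (simp add: X_k' sum_distrib_left flip: sum_subtractf) (simp add: algebra_simps)
      also have "\<dots> = 0"
        using c[OF cube(1)] c[OF cube(2)] by (simp add: X_k')
      finally show "(\<Sum>j=1..M. c j * (x j $ i - y $ i) * X (x j) k) = 0" .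
    qed
    then have coord: "c j = 0 \<or> x j = y" if "j \<in> {1..M}" for j
      using that by (auto simp: vec_eq_iff)
    \<comment> \<open>The exponent 0 evaluates to 1 at every point, even when \<open>y\<close> has
      zero coordinates.\<close>
    have "(\<Sum>j=1..M. c j) = 1"
      using c[of 0] by (simp add: index_cube_def X_def)
    then obtain j where "j \<in> {1..M}" "c j \<noteq> 0"
      by (metis sum.neutral zero_neq_one)
    with coord show "y \<in> \<Omega>"
      using assms(6) by blast
  qed
qed

end
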